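(* Let $0\le p<\alpha-3$, $\beta(t)=t^p$, $L>0$, and let $f_1,\dots,f_m:\mathbb{R}^n\to\mathbb{R}$ be convex, bounded from below, and differentiable with $L$-Lipschitz continuous gradients. Assume that $F=(f_1,\dots,f_m)^\top$ satisfies Assumption (R). Let $x:[1,+\infty)\to\mathbb{R}^n$ be a bounded solution of (MITS) with $(x(1),\dot x(1))=(x_0,0)$, where $x_0\in\mathbb{R}^n$, and let $x^*=\lim_{t\to\infty}x(t)$ (this limit exists under the present hypotheses and is weakly Pareto optimal). Then, with $$\mathcal W_{x^*}(t):=\min_{i\in\{1,\dots,m\}}\bigl(f_i(x(t))-f_i(x^* )\bigr)+\frac{1}{2t^p}\|\dot x(t)\|^2,$$ one has $\mathcal W_{x^*}(t)=o\!\left(\frac{1}{t^{2+p}}\right)$ as $t\to+\infty$.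
   Context: Notation: $[m]=\{1,\dots,m\}$; inequalities between vectors are componentwise. A point $x^*\in\mathbb{R}^n$ is weakly Pareto optimal if there is no $y$ with $f_i(y)<f_i(x^* )$ for all $i\in[m]$; $\mathcal P_w$ is the set of weakly Pareto optimal points. $\mathcal L(F,a):=\{x: F(x)\le a\}$ and $\mathcal{LP}_w(F,a):=\mathcal P_w\cap\mathcal L(F,a)$. Assumption (R): for every $y_0\in\mathbb{R}^n$, the set $\mathcal{LP}_w(F,F(y_0))$ is nonempty and $$\mathbf R(y_0):=\sup_{F^*\in F(\mathcal{LP}_w(F,F(y_0)))}\ \inf_{z\in F^{-1}(F^* )}\tfrac12\|z-y_0\|^2<+\infty .$$ $C(x):=\mathrm{co}\{\nabla f_i(x):i\in[m]\}$ and $\mathrm{Proj}_K$ is Euclidean projection onto the closed convex set $K$. A solution of (MITS) with $(x(1),\dot x(1))=(x_0,0)$ is a $C^1$ function $x:[1,+\infty)\to\mathbb{R}^n$ such that $\dot x$ is absolutely continuous on every $[1,T]$, with almost-everywhere derivative $\ddot x$, $x(1)=x_0$, $\dot x(1)=0$, and $$\frac{\alpha}{t}\dot x(t)+\mathrm{Proj}_{\beta(t)C(x(t))+\ddot x(t)}(0)=0\quad\text{for almost all }t\ge1.$$ *)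

theory Defs
  imports "HOL-Analysis.Analysis" "HOL-Library.Landau_Symbols"
begin

text \<open>
  A vector-valued objective is a map F from \<open>real ^ 'n\<close> to \<open>real ^ 'm\<close> with components
  \<open>f\<^sub>i = (\<lambda>x. F x $ i)\<close>; the index set \<open>[m]\<close> is the (finite, nonempty) type \<open>'m\<close>.
  On \<open>real ^ 'm\<close> the library relation \<open>\<le>\<close> is componentwise, but \<open><\<close> is not the
  componentwise strict order, so strict inequalities are spelled out by component.
\<close>

definition gradient :: "('a::real_inner \<Rightarrow> real) \<Rightarrow> 'a \<Rightarrow> 'a" where
  "gradient f x = (THE D. GDERIV f x :> D)"

definition weakly_pareto :: "(real ^ 'n \<Rightarrow> real ^ 'm) \<Rightarrow> (real ^ 'n) set" where
  "weakly_pareto F = {x. \<not> (\<exists>y. \<forall>i. F y $ i < F x $ i)}"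

definition level_set :: "(real ^ 'n \<Rightarrow> real ^ 'm) \<Rightarrow> real ^ 'm \<Rightarrow> (real ^ 'n) set" where
  "level_set F a = {x. F x \<le> a}"

definition level_weakly_pareto :: "(real ^ 'n \<Rightarrow> real ^ 'm) \<Rightarrow> real ^ 'm \<Rightarrow> (real ^ 'n) set" where
  "level_weakly_pareto F a = weakly_pareto F \<inter> level_set F a"

text \<open>The supremum and infimum are taken in the extended reals, so that an unbounded
  supremum is really infinite.\<close>

definition merit_radius :: "(real ^ 'n \<Rightarrow> real ^ 'm) \<Rightarrow> real ^ 'n \<Rightarrow> ereal" where
  "merit_radius F y0 =
    (SUP a \<in> F ` level_weakly_pareto F (F y0).
       INF z \<in> F -` {a}. ereal (1 / 2 * (norm (z - y0))\<^sup>2))"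

definition assumption_R :: "(real ^ 'n \<Rightarrow> real ^ 'm) \<Rightarrow> bool" where
  "assumption_R F \<longleftrightarrow>
    (\<forall>y0. level_weakly_pareto F (F y0) \<noteq> {} \<and> merit_radius F y0 < \<infinity>)"

definition grad_hull :: "(real ^ 'n \<Rightarrow> real ^ 'm) \<Rightarrow> real ^ 'n \<Rightarrow> (real ^ 'n) set" where
  "grad_hull F x = convex hull (range (\<lambda>i. gradient (\<lambda>y. F y $ i) x))"

text \<open>Absolute continuity of a function on a set of reals (the library has it only for
  measures). A pair \<open>(a, b)\<close> stands for the interval \<open>{a..b}\<close>; intervals of a family may
  share endpoints.\<close>

definition absolutely_continuous_on :: "real set \<Rightarrow> (real \<Rightarrow> 'a::metric_space) \<Rightarrow> bool" where
  "absolutely_continuous_on S g \<longleftrightarrow>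
    (\<forall>\<epsilon>>0. \<exists>\<delta>>0. \<forall>I. finite I \<longrightarrow>
       (\<forall>(a, b) \<in> I. a \<le> b \<and> {a..b} \<subseteq> S) \<longrightarrow>
       disjoint_family_on (\<lambda>(a, b). {a<..<b}) I \<longrightarrow>
       (\<Sum>(a, b) \<in> I. b - a) < \<delta> \<longrightarrow>
       (\<Sum>(a, b) \<in> I. dist (g a) (g b)) < \<epsilon>)"

text \<open>Trajectories live on \<open>{1..}\<close>: derivatives are taken within that set (one-sided at
  time 1), and the values of x at times below 1 are irrelevant.\<close>

definition velocity :: "(real \<Rightarrow> real ^ 'n) \<Rightarrow> real \<Rightarrow> real ^ 'n" where
  "velocity x t = vector_derivative x (at t within {1..})"

text \<open>The function \<open>acc\<close> below is the almost-everywhere derivative of the velocity;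
  \<open>closest_point K 0\<close> is the Euclidean projection of 0 onto K.\<close>

definition mits_solution ::
  "real \<Rightarrow> (real \<Rightarrow> real) \<Rightarrow> (real ^ 'n \<Rightarrow> real ^ 'm) \<Rightarrow> real ^ 'n \<Rightarrow> (real \<Rightarrow> real ^ 'n) \<Rightarrow> bool"
where
  "mits_solution \<alpha> \<beta> F x0 x \<longleftrightarrow>
     (\<forall>t\<ge>1. x differentiable (at t within {1..})) \<and>
     continuous_on {1..} (velocity x) \<and>
     (\<forall>T\<ge>1. absolutely_continuous_on {1..T} (velocity x)) \<and>
     x 1 = x0 \<and> velocity x 1 = 0 \<and>
     (\<exists>acc. AE t in lborel. 1 \<le> t \<longrightarrow>
        (velocity x has_vector_derivative acc t) (at t within {1..}) \<and>
        (\<alpha> / t) *\<^sub>R velocity x t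
          + closest_point ((\<lambda>c. \<beta> t *\<^sub>R c + acc t) ` grad_hull F (x t)) 0 = 0)"

definition energy_W ::
  "real \<Rightarrow> (real ^ 'n \<Rightarrow> real ^ 'm) \<Rightarrow> (real \<Rightarrow> real ^ 'n) \<Rightarrow> real ^ 'n \<Rightarrow> real \<Rightarrow> real"
where
  "energy_W p F x z t =
     (MIN i. F (x t) $ i - F z $ i) + 1 / (2 * t powr p) * (norm (velocity x t))\<^sup>2"

end

theory Submission
  imports Defs "HOL-Real_Asymp.Real_Asymp"
begin

text \<open>
  Along a solution each \<open>f\<^sub>i(x) + |v|\<^sup>2 / (2 t\<^sup>p)\<close> is nonincreasing, and \<open>|v|\<^sup>2 / t\<^sup>p\<close> is
  small along a sequence of times, so a cluster point \<open>z\<close> of \<open>x\<close> exists for which \<open>W\<^sub>z\<close> is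
  nonnegative and nonincreasing. With \<open>\<eta> = (\<alpha> - 3 - p) / 2\<close> and \<open>\<Lambda> = 2 + p + \<eta>\<close> the energy
  \<open>E\<^sub>z = t\<^sup>2\<^sup>+\<^sup>p \<sigma>\<^sub>z + |\<Lambda> (x - z) + t v|\<^sup>2 / 2 + \<Lambda> \<eta> |x - z|\<^sup>2 / 2\<close>, where \<open>\<sigma>\<^sub>z\<close> is the least
  \<open>f\<^sub>i(x) - f\<^sub>i(z)\<close>, satisfies \<open>E\<^sub>z' \<le> - \<eta> t\<^sup>1\<^sup>+\<^sup>p W\<^sub>z\<close> for every \<open>z\<close>. In terms of
  \<open>h = |x - z|\<^sup>2 / 2\<close> it equals \<open>t\<^sup>2\<^sup>+\<^sup>p W\<^sub>z + \<Lambda> t h' + \<Lambda> (\<alpha> - 1) h\<close>, so for the cluster point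
  \<open>E\<^sub>z\<close> cannot become negative (otherwise \<open>h'\<close> would lie below a multiple of \<open>- 1 / t\<close>) and hence
  converges. Comparing the times \<open>t / 2\<close> and \<open>t\<close> yields \<open>t\<^sup>2\<^sup>+\<^sup>p W\<^sub>z \<rightarrow> 0\<close>; then \<open>\<Lambda> t h' + \<Lambda> (\<alpha> - 1) h\<close>
  converges, so does \<open>h\<close>, and its limit is \<open>0\<close> since \<open>z\<close> is a cluster point. If some \<open>y\<close>
  strictly dominated \<open>z\<close>, then \<open>E\<^sub>y\<close> would eventually be nonnegative yet decrease at least linearly.
\<close>

section \<open>Monotonicity from almost everywhere derivatives\<close>

lemma absolutely_continuous_on_subset:
  assumes "absolutely_continuous_on T g" "S \<subseteq> T"
  shows "absolutely_continuous_on S g"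
  unfolding absolutely_continuous_on_def
proof (intro allI impI)
  fix e :: real assume "e > 0"
  then obtain d where d: "d > 0" "\<And>I. finite I \<Longrightarrow> (\<forall>(a, b) \<in> I. a \<le> b \<and> {a..b} \<subseteq> T) \<Longrightarrow>
       disjoint_family_on (\<lambda>(a, b). {a<..<b}) I \<Longrightarrow> (\<Sum>(a, b) \<in> I. b - a) < d \<Longrightarrow>
       (\<Sum>(a, b) \<in> I. dist (g a) (g b)) < e"
    using assms(1) unfolding absolutely_continuous_on_def by meson
  show "\<exists>\<delta>>0. \<forall>I. finite I \<longrightarrow> (\<forall>(a, b)\<in>I. a \<le> b \<and> {a..b} \<subseteq> S) \<longrightarrow>
    disjoint_family_on (\<lambda>(a, b). {a<..<b}) I \<longrightarrow> (\<Sum>(a, b)\<in>I. b - a) < \<delta> \<longrightarrow>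
    (\<Sum>(a, b)\<in>I. dist (g a) (g b)) < e"
  proof (intro exI[of _ d] conjI allI impI d)
    fix I assume "\<forall>(a, b)\<in>I. a \<le> b \<and> {a..b} \<subseteq> S"
    then show "\<forall>(a, b)\<in>I. a \<le> b \<and> {a..b} \<subseteq> T"
      using \<open>S \<subseteq> T\<close> by fastforce
  qed
qed

text \<open>Take a tagged division fine for a suitable gauge: cells tagged outside the exceptional null
  set contribute at most \<open>e * (b - a)\<close>; the others have small total length, so absolute
  continuity of \<open>V\<close> makes their contribution small.\<close>

lemma decreasing_of_absolutely_continuous:
  fixes V :: "real \<Rightarrow> 'a::metric_space" and g :: "real \<Rightarrow> real"
  assumes ab: "a \<le> b" and ac: "absolutely_continuous_on {a..b} V"
    and lip: "\<And>u v. u \<in> {a..b} \<Longrightarrow> v \<in> {a..b} \<Longrightarrow> \<bar>g v - g u\<bar> \<le> K * (\<bar>v - u\<bar> + dist (V u) (V v))"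
    and ae: "AE t in lborel. t \<in> {a..b} \<longrightarrow> (\<forall>e>0. \<exists>d>0. \<forall>u v.
        a \<le> u \<longrightarrow> u \<le> t \<longrightarrow> t \<le> v \<longrightarrow> v \<le> b \<longrightarrow> v - u < d \<longrightarrow> g v - g u \<le> e * (v - u))"
  shows "g b \<le> g a"
proof -
  obtain N where N: "N \<in> null_sets lborel"
    and good: "\<And>t. t \<in> space lborel - N \<Longrightarrow> t \<in> {a..b} \<longrightarrow> (\<forall>e>0. \<exists>d>0. \<forall>u v.
        a \<le> u \<longrightarrow> u \<le> t \<longrightarrow> t \<le> v \<longrightarrow> v \<le> b \<longrightarrow> v - u < d \<longrightarrow> g v - g u \<le> e * (v - u))"
    using AE_E3[OF ae] by metis
  have key: "g b - g a \<le> e * (b - a) + \<bar>K\<bar> * (2 * e)" if e: "e > 0" for e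
  proof -
    obtain \<delta> where "\<delta> > 0" and \<delta>: "\<And>I. finite I \<Longrightarrow> (\<forall>(u, v) \<in> I. u \<le> v \<and> {u..v} \<subseteq> {a..b}) \<Longrightarrow>
       disjoint_family_on (\<lambda>(u, v). {u<..<v}) I \<Longrightarrow> (\<Sum>(u, v) \<in> I. v - u) < \<delta> \<Longrightarrow>
       (\<Sum>(u, v) \<in> I. dist (V u) (V v)) < e"
      using ac e unfolding absolutely_continuous_on_def by meson
    \<comment> \<open>At most \<open>\<delta>\<close>, so that absolute continuity applies to the
      cells inside \<open>U\<close>; at most \<open>e\<close>, because the Lipschitz bound contains
      the length of these cells as well as the variation of \<open>V\<close>. Together they account
      for the \<open>2 * e\<close> in the claim.\<close>
    define \<mu> where "\<mu> = min \<delta> e"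
    have \<mu>: "\<mu> > 0" "\<mu> \<le> \<delta>" "\<mu> \<le> e" using \<open>\<delta> > 0\<close> e by (auto simp: \<mu>_def)
    have Nb: "N \<in> sets borel" using N by auto
    obtain U where U: "open U" "N \<subseteq> U" "emeasure lborel (U - N) < ennreal \<mu>"
      using outer_regular_lborel[OF Nb \<mu>(1)] by blast
    have "emeasure lborel U \<le> emeasure lborel (U - N) + emeasure lborel N"
      using emeasure_subadditive[of "U - N" lborel N] U(1) Nb
      by (metis Un_Diff_cancel2 Un_absorb2 U(2) borel_open sets.Diff sets_lborel)
    then have Um: "emeasure lborel U < ennreal \<mu>"
      using U(3) N by auto
    \<comment> \<open>A tag in the null set gets \<open>U\<close> itself; a good tag gets a ball of
      radius \<open>d / 2\<close>, so that every cell inside it is shorter than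
      \<open>d\<close>.\<close>
    have "\<exists>G. open G \<and> t \<in> G \<and> (t \<in> N \<longrightarrow> G \<subseteq> U) \<and> (t \<notin> N \<longrightarrow> t \<in> {a..b} \<longrightarrow>
       (\<forall>u v. a \<le> u \<longrightarrow> u \<le> t \<longrightarrow> t \<le> v \<longrightarrow> v \<le> b \<longrightarrow> {u..v} \<subseteq> G \<longrightarrow> g v - g u \<le> e * (v - u)))" for t
    proof (cases "t \<in> N \<or> t \<notin> {a..b}")
      case True then show ?thesis
      proof
        assume "t \<in> N" then show ?thesis using U by (intro exI[of _ U]) auto
      next
        assume "t \<notin> {a..b}" then show ?thesis using U
          by (intro exI[of _ "if t \<in> N then U else UNIV"]) auto
      qed
    next
      case False
      then obtain d where d: "d > 0" "\<And>u v.
        a \<le> u \<Longrightarrow> u \<le> t \<Longrightarrow> t \<le> v \<Longrightarrow> v \<le> b \<Longrightarrow> v - u < d \<Longrightarrow> g v - g u \<le> e * (v - u)"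
        using good[of t] e by auto
      show ?thesis
      proof (rule exI[of _ "ball t (d/2)"], intro conjI impI allI d; (use False d(1) in simp)?)
        fix u v assume *: "u \<le> t" "t \<le> v" "{u..v} \<subseteq> ball t (d/2)"
        then have "u \<in> ball t (d/2)" "v \<in> ball t (d/2)"
          using subsetD[OF *(3), of u] subsetD[OF *(3), of v] by simp_all
        then show "v - u < d" using *(1,2) by (simp add: dist_real_def)
      qed
    qed
    then obtain \<gamma> where \<gamma>: "\<And>t. open (\<gamma> t)" "\<And>t. t \<in> \<gamma> t" "\<And>t. t \<in> N \<Longrightarrow> \<gamma> t \<subseteq> U"
      "\<And>t u v. t \<notin> N \<Longrightarrow> t \<in> {a..b} \<Longrightarrow> a \<le> u \<Longrightarrow> u \<le> t \<Longrightarrow> t \<le> v \<Longrightarrow> v \<le> b \<Longrightarrow>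
        {u..v} \<subseteq> \<gamma> t \<Longrightarrow> g v - g u \<le> e * (v - u)"
      by metis
    have "gauge \<gamma>" using \<gamma> by (simp add: gauge_def)
    then obtain P where P: "P tagged_division_of {a..b}" "\<gamma> fine P"
      by (rule fine_division_exists_real)
    have finP: "finite P" using P by auto
    have cell: "k = {Inf k..Sup k} \<and> Inf k \<le> t \<and> t \<le> Sup k \<and> a \<le> Inf k \<and> Sup k \<le> b \<and> k \<subseteq> \<gamma> t"
      if tk: "(t, k) \<in> P" for t k
    proof -
      obtain u v where k: "k = cbox u v" using tagged_division_ofD(4)[OF P(1) tk] by blast
      have "t \<in> k" "k \<subseteq> {a..b}" "k \<subseteq> \<gamma> t"
        using tagged_division_ofD(2,3)[OF P(1) tk] P(2) tk by (auto simp: fine_def)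
      then show ?thesis unfolding k by auto
    qed
    define P1 where "P1 = {x \<in> P. fst x \<in> N}"
    define P2 where "P2 = {x \<in> P. fst x \<notin> N}"
    have P12: "P = P1 \<union> P2" "P1 \<inter> P2 = {}" "finite P1" "finite P2" "P1 \<subseteq> P" "P2 \<subseteq> P"
      using finP by (auto simp: P1_def P2_def)
    define h where "h = (\<lambda>(t::real, k::real set). (Inf k, Sup k))"
    define I where "I = h ` P1"
    \<comment> \<open>Passing from cells to pairs of endpoints is not injective: a degenerate cell
      may share its pair with others. Two distinct members with equal nondegenerate cells are
      excluded by disjointness of interiors, and degenerate ones contribute zero, whence the
      condition on \<open>\<phi>\<close> in \<open>reindex\<close>.\<close>
    have same: "Inf k = Sup k \<or> x = (t, k)" if x: "x \<in> P" "(t, k) \<in> P" "h x = h (t, k)" for x t k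
    proof (rule ccontr)
      assume n: "\<not> ?thesis"
      obtain t' k' where x': "x = (t', k')" by fastforce
      have "k' = k" using cell[of t' k'] cell[of t k] x x' by (auto simp: h_def)
      then have "interior k = {}" using tagged_division_ofD(5)[OF P(1), of t' k' t k] x x' n by auto
      moreover have "interior k = {Inf k<..<Sup k}"
        using cell[OF x(2)] interior_atLeastAtMost_real by metis
      moreover have "Inf k < Sup k" using n cell[OF x(2)] by auto
      ultimately show False using dense by fastforce
    qed
    have reindex: "(\<Sum>(u, v) \<in> I. \<phi> u v) = (\<Sum>(t, k) \<in> P1. \<phi> (Inf k) (Sup k))"
      if "\<And>u. \<phi> u u = 0" for \<phi> :: "real \<Rightarrow> real \<Rightarrow> real"
      unfolding I_def
    proof (subst sum.reindex_nontrivial)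
      show "finite P1" by (rule P12)
      fix x y assume "x \<in> P1" "y \<in> P1" "x \<noteq> y" "h x = h y"
      then show "(case h x of (u, v) \<Rightarrow> \<phi> u v) = 0"
        using same[of x "fst y" "snd y"] that P12 by (cases y) (auto simp: h_def)
    qed (auto simp: h_def case_prod_beta o_def)
    have Ifin: "finite I" using P12 by (simp add: I_def)
    have Isub: "u \<le> v \<and> {u..v} \<subseteq> {a..b} \<and> {u..v} \<subseteq> U" if uv: "(u, v) \<in> I" for u v
    proof -
      obtain t k where tk: "(t, k) \<in> P1" "u = Inf k" "v = Sup k"
        using uv by (auto simp: I_def h_def)
      then have "(t, k) \<in> P" "t \<in> N" by (auto simp: P1_def)
      then have "{u..v} = k" "k \<subseteq> {a..b}" "k \<subseteq> U" "u \<le> v"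
        using cell[of t k] \<gamma>(3)[of t] tagged_division_ofD(3)[OF P(1), of t k] tk(2,3) by auto
      then show ?thesis by simp
    qed
    have Idisj: "disjoint_family_on (\<lambda>(u, v). {u<..<v}) I"
      unfolding disjoint_family_on_def
    proof (intro ballI impI)
      fix x y assume xy: "x \<in> I" "y \<in> I" "x \<noteq> y"
      then obtain t k t' k' where *: "(t, k) \<in> P" "(t', k') \<in> P" "x = (Inf k, Sup k)" "y = (Inf k', Sup k')"
        unfolding I_def h_def P1_def by auto
      have "interior k \<inter> interior k' = {}"
        using tagged_division_ofD(5)[OF P(1) *(1,2)] xy * by auto
      then show "(case x of (u, v) \<Rightarrow> {u<..<v}) \<inter> (case y of (u, v) \<Rightarrow> {u<..<v}) = {}"
        using cell[OF *(1)] cell[OF *(2)] *(3,4)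
        by (metis case_prod_conv interior_atLeastAtMost_real)
    qed
    \<comment> \<open>The total length is the measure of a disjoint union of open intervals, which
      lies in \<open>U\<close> and therefore has measure below \<open>\<mu>\<close>.\<close>
    have "(\<Sum>(u, v) \<in> I. v - u) = (\<Sum>x \<in> I. measure lborel (case x of (u, v) \<Rightarrow> {u<..<v}))"
      using Isub by (intro sum.cong) auto
    also have "\<dots> = measure lborel (\<Union>x\<in>I. case x of (u, v) \<Rightarrow> {u<..<v})"
    proof (rule measure_UNION'[symmetric])
      show "pairwise (\<lambda>i j. disjnt (case i of (u, v) \<Rightarrow> {u<..<v}) (case j of (u, v) \<Rightarrow> {u<..<v})) I"
        using Idisj by (auto simp: pairwise_def disjnt_def disjoint_family_on_def)
    qed (use Ifin Isub in \<open>auto simp: fmeasurable_def emeasure_lborel_Ioo\<close>)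
    also have "\<dots> \<le> measure lborel U"
    proof (rule measure_mono_fmeasurable)
      show "(\<Union>x\<in>I. case x of (u, v) \<Rightarrow> {u<..<v}) \<subseteq> U"
        using Isub by fastforce
      show "U \<in> fmeasurable lborel"
        using U(1) Um by (auto simp: fmeasurable_def less_top[symmetric] top_unique)
      show "(\<Union>x\<in>I. case x of (u, v) \<Rightarrow> {u<..<v}) \<in> sets lborel"
        using Ifin by (auto intro!: sets.finite_UN)
    qed
    also have "\<dots> < \<mu>"
      using Um \<mu>(1) by (metis emeasure_eq_ennreal_measure ennreal_less_iff measure_nonneg
          order_less_imp_not_less top.not_eq_extremum ennreal_less_top)
    finally have len: "(\<Sum>(u, v) \<in> I. v - u) < \<mu>" .
    have var: "(\<Sum>(u, v) \<in> I. dist (V u) (V v)) < e"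
      using \<delta>[OF Ifin _ Idisj] Isub len \<mu> by fastforce
    have tele: "(\<Sum>(t, k) \<in> P. f (Sup k) - f (Inf k)) = f b - f a" for f :: "real \<Rightarrow> real"
      by (rule additive_tagged_division_1[OF ab P(1)])
    have "(\<Sum>(t, k) \<in> P1. g (Sup k) - g (Inf k))
        \<le> (\<Sum>(t, k) \<in> P1. \<bar>K\<bar> * ((Sup k - Inf k) + dist (V (Inf k)) (V (Sup k))))"
    proof (rule sum_mono, clarify)
      fix t k assume "(t, k) \<in> P1"
      then have c: "Inf k \<in> {a..b}" "Sup k \<in> {a..b}" "Inf k \<le> Sup k"
        using cell[of t k] P12 by (auto simp: subset_iff)
      have "g (Sup k) - g (Inf k) \<le> K * (\<bar>Sup k - Inf k\<bar> + dist (V (Inf k)) (V (Sup k)))"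
        using lip[OF c(1,2)] by linarith
      also have "\<dots> \<le> \<bar>K\<bar> * (\<bar>Sup k - Inf k\<bar> + dist (V (Inf k)) (V (Sup k)))"
        by (intro mult_right_mono) auto
      finally show "g (Sup k) - g (Inf k) \<le> \<bar>K\<bar> * ((Sup k - Inf k) + dist (V (Inf k)) (V (Sup k)))"
        using c by simp
    qed
    also have "\<dots> = \<bar>K\<bar> * ((\<Sum>(u, v) \<in> I. v - u) + (\<Sum>(u, v) \<in> I. dist (V u) (V v)))"
      by (subst (1 2) reindex) (simp_all add: sum.distrib[symmetric] sum_distrib_left case_prod_beta)
    also have "\<dots> \<le> \<bar>K\<bar> * (2 * e)"
      using len var \<mu> by (intro mult_left_mono) auto
    finally have s1: "(\<Sum>(t, k) \<in> P1. g (Sup k) - g (Inf k)) \<le> \<bar>K\<bar> * (2 * e)" .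
    have "(\<Sum>(t, k) \<in> P2. g (Sup k) - g (Inf k)) \<le> (\<Sum>(t, k) \<in> P2. e * (Sup k - Inf k))"
    proof (rule sum_mono, clarify)
      fix t k assume "(t, k) \<in> P2"
      then show "g (Sup k) - g (Inf k) \<le> e * (Sup k - Inf k)"
        using cell[of t k] \<gamma>(4)[of t "Inf k" "Sup k"] by (auto simp: P2_def)
    qed
    \<comment> \<open>Adding the cells tagged in \<open>N\<close> only enlarges a sum of nonnegative
      lengths, and the sum over the whole division telescopes.\<close>
    also have "\<dots> \<le> (\<Sum>(t, k) \<in> P. e * (Sup k - Inf k))"
    proof (rule sum_mono2[OF finP P12(6)])
      fix x assume "x \<in> P - P2"
      then show "0 \<le> (case x of (t, k) \<Rightarrow> e * (Sup k - Inf k))"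
        using e cell[of "fst x" "snd x"] by (auto simp: case_prod_beta)
    qed
    also have "\<dots> = e * (b - a)"
      using tele[of "\<lambda>x. e * x"] by (simp add: algebra_simps)
    finally have s2: "(\<Sum>(t, k) \<in> P2. g (Sup k) - g (Inf k)) \<le> e * (b - a)" .
    have "g b - g a = (\<Sum>(t, k) \<in> P1. g (Sup k) - g (Inf k)) + (\<Sum>(t, k) \<in> P2. g (Sup k) - g (Inf k))"
      using tele[of g] P12 by (metis sum.union_disjoint)
    then show ?thesis using s1 s2 by simp
  qed
  have alg: "q * (b - a) + \<bar>K\<bar> * (2 * q) = ((b - a) + 2 * \<bar>K\<bar>) * q" for q
    by (simp add: algebra_simps)
  show ?thesis
  proof (rule field_le_epsilon)
    fix e :: real assume "e > 0"
    \<comment> \<open>The summand 1 keeps \<open>c\<close> positive when \<open>a = b\<close> and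
      \<open>K = 0\<close>.\<close>
    define c where "c = (b - a) + 2 * \<bar>K\<bar> + 1"
    have c: "c > 0" "(b - a) + 2 * \<bar>K\<bar> \<le> c" using ab by (auto simp: c_def)
    have "g b - g a \<le> e / c * (b - a) + \<bar>K\<bar> * (2 * (e / c))"
      using key[of "e / c"] \<open>e > 0\<close> c by simp
    also have "\<dots> = ((b - a) + 2 * \<bar>K\<bar>) * (e / c)"
      by (rule alg)
    also have "\<dots> \<le> c * (e / c)" using c \<open>e > 0\<close> by (intro mult_right_mono) auto
    finally show "g b \<le> g a + e" using c by simp
  qed
qed

text \<open>Functions that are Lipschitz jointly in time and in the absolutely continuous \<open>V\<close>. Stability
  of this notion under sums and products replaces a calculus of absolutely continuous functions.\<close>

definition lipschitz_along ::
  "(real \<Rightarrow> 'a::metric_space) \<Rightarrow> real set \<Rightarrow> (real \<Rightarrow> 'b::real_normed_vector) \<Rightarrow> bool" where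
  "lipschitz_along V S g \<longleftrightarrow>
    (\<exists>K\<ge>0. \<forall>u\<in>S. \<forall>v\<in>S. norm (g v - g u) \<le> K * (\<bar>v - u\<bar> + dist (V u) (V v)))"

lemma lipschitz_alongI:
  "K \<ge> 0 \<Longrightarrow> (\<And>u v. u \<in> S \<Longrightarrow> v \<in> S \<Longrightarrow> norm (g v - g u) \<le> K * (\<bar>v - u\<bar> + dist (V u) (V v)))
    \<Longrightarrow> lipschitz_along V S g"
  unfolding lipschitz_along_def by blast

lemma lipschitz_along_self: "lipschitz_along V S V"
  by (rule lipschitz_alongI[of 1]) (auto simp: dist_norm norm_minus_commute)

text \<open>The derivative is bounded on the compact interval, so the mean value inequality gives a
  Lipschitz bound in time alone; the term with \<open>V\<close> only enlarges the right-hand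
  side.\<close>

lemma lipschitz_along_C1:
  assumes "\<And>t. t \<in> {a..b} \<Longrightarrow> (g has_vector_derivative g' t) (at t within {a..b})"
    and "continuous_on {a..b} g'"
  shows "lipschitz_along V {a..b} g"
proof -
  obtain B where B: "B > 0" "\<And>t. t \<in> {a..b} \<Longrightarrow> norm (g' t) \<le> B"
    using compact_imp_bounded[OF compact_continuous_image[OF assms(2)]]
    by (auto simp: bounded_pos)
  show ?thesis
  proof (rule lipschitz_alongI[of B])
    fix u v assume "u \<in> {a..b}" "v \<in> {a..b}"
    then have "norm (g v - g u) \<le> B * norm (v - u)"
    proof (intro differentiable_bound[where S = "{a..b}" and f' = "\<lambda>t h. h *\<^sub>R g' t"])
      show "(g has_derivative (\<lambda>h. h *\<^sub>R g' t)) (at t within {a..b})" if "t \<in> {a..b}" for t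
        using assms(1)[OF that] by (simp add: has_vector_derivative_def)
      show "onorm (\<lambda>h. h *\<^sub>R g' t) \<le> B" if "t \<in> {a..b}" for t
        using B(2)[OF that] by (intro onorm_le) (simp add: mult.commute[of B] mult_left_mono)
    qed auto
    also have "\<dots> \<le> B * (\<bar>v - u\<bar> + dist (V u) (V v))"
      using B by (intro mult_left_mono) auto
    finally show "norm (g v - g u) \<le> B * (\<bar>v - u\<bar> + dist (V u) (V v))" .
  qed (use B in simp)
qed

lemma lipschitz_along_add:
  assumes "lipschitz_along V S f" "lipschitz_along V S g"
  shows "lipschitz_along V S (\<lambda>t. f t + g t)"
proof -
  obtain K L where K: "K \<ge> 0" "\<And>u v. u \<in> S \<Longrightarrow> v \<in> S \<Longrightarrow> norm (f v - f u) \<le> K * (\<bar>v - u\<bar> + dist (V u) (V v))"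
    and L: "L \<ge> 0" "\<And>u v. u \<in> S \<Longrightarrow> v \<in> S \<Longrightarrow> norm (g v - g u) \<le> L * (\<bar>v - u\<bar> + dist (V u) (V v))"
    using assms unfolding lipschitz_along_def by metis
  show ?thesis
  proof (rule lipschitz_alongI[of "K + L"])
    fix u v assume uv: "u \<in> S" "v \<in> S"
    have "norm (f v + g v - (f u + g u)) \<le> norm (f v - f u) + norm (g v - g u)"
      by (metis add_diff_add norm_triangle_ineq)
    then show "norm (f v + g v - (f u + g u)) \<le> (K + L) * (\<bar>v - u\<bar> + dist (V u) (V v))"
      using K(2)[OF uv] L(2)[OF uv] by (simp add: distrib_right)
  qed (use K L in simp)
qed

lemma lipschitz_along_bounded:
  assumes "lipschitz_along V S g" "bounded S" "bounded (V ` S)"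
  shows "bounded (g ` S)"
proof (cases "S = {}")
  case False
  then obtain s where s: "s \<in> S" by blast
  obtain K where K: "K \<ge> 0" "\<And>u v. u \<in> S \<Longrightarrow> v \<in> S \<Longrightarrow> norm (g v - g u) \<le> K * (\<bar>v - u\<bar> + dist (V u) (V v))"
    using assms(1) unfolding lipschitz_along_def by metis
  obtain A where A: "\<And>u. u \<in> S \<Longrightarrow> dist s u \<le> A"
    using assms(2) by (auto simp: bounded_any_center[where a = s])
  obtain B where B: "\<And>u. u \<in> S \<Longrightarrow> dist (V s) (V u) \<le> B"
    using assms(3) by (auto simp: bounded_any_center[where a = "V s"])
  have "dist (g s) (g u) \<le> K * (A + B)" if u: "u \<in> S" for u
  proof -
    have "dist (g s) (g u) \<le> K * (\<bar>u - s\<bar> + dist (V s) (V u))"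
      using K(2)[OF s u] by (simp add: dist_norm norm_minus_commute)
    also have "\<dots> \<le> K * (A + B)"
      using A[OF u] B[OF u] K by (intro mult_left_mono add_mono) (auto simp: dist_real_def)
    finally show ?thesis .
  qed
  then show ?thesis by (auto simp: bounded_def)
qed simp

text \<open>The increment of a product splits into two terms, each pairing the increment of one
  factor with a value of the other. Boundedness of \<open>S\<close> and of \<open>V\<close> on it
  bounds those values.\<close>

lemma lipschitz_along_bilinear:
  assumes "bounded_bilinear h" and f: "lipschitz_along V S f" and g: "lipschitz_along V S g"
    and bd: "bounded S" "bounded (V ` S)"
  shows "lipschitz_along V S (\<lambda>t. h (f t) (g t))"
proof -
  interpret bounded_bilinear h by fact
  obtain K L where K: "K \<ge> 0" "\<And>u v. u \<in> S \<Longrightarrow> v \<in> S \<Longrightarrow> norm (f v - f u) \<le> K * (\<bar>v - u\<bar> + dist (V u) (V v))"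
    and L: "L \<ge> 0" "\<And>u v. u \<in> S \<Longrightarrow> v \<in> S \<Longrightarrow> norm (g v - g u) \<le> L * (\<bar>v - u\<bar> + dist (V u) (V v))"
    using f g unfolding lipschitz_along_def by metis
  obtain A where A: "A > 0" "\<And>u. u \<in> S \<Longrightarrow> norm (f u) \<le> A"
    using lipschitz_along_bounded[OF f bd] by (auto simp: bounded_pos)
  obtain B where B: "B > 0" "\<And>u. u \<in> S \<Longrightarrow> norm (g u) \<le> B"
    using lipschitz_along_bounded[OF g bd] by (auto simp: bounded_pos)
  obtain M where M: "M > 0" "\<And>x y. norm (h x y) \<le> norm x * norm y * M"
    using pos_bounded by blast
  show ?thesis
  proof (rule lipschitz_alongI[of "(K * B + A * L) * M"])
    fix u v assume uv: "u \<in> S" "v \<in> S"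
    define r where "r = \<bar>v - u\<bar> + dist (V u) (V v)"
    have "r \<ge> 0" by (simp add: r_def)
    have "norm (h (f v) (g v) - h (f u) (g u))
        = norm (h (f v - f u) (g v) + h (f u) (g v - g u))"
      by (simp add: diff_left diff_right)
    also have "\<dots> \<le> norm (f v - f u) * norm (g v) * M + norm (f u) * norm (g v - g u) * M"
      by (intro norm_triangle_mono M)
    also have "\<dots> \<le> (K * r) * B * M + A * (L * r) * M"
      using K(2)[OF uv] L(2)[OF uv] A(2)[OF uv(1)] B(2)[OF uv(2)] A(1) K(1) B(1) L(1) M(1) \<open>r \<ge> 0\<close>
      by (intro add_mono mult_mono mult_nonneg_nonneg) (auto simp: r_def)
    finally show "norm (h (f v) (g v) - h (f u) (g u))
        \<le> (K * B + A * L) * M * (\<bar>v - u\<bar> + dist (V u) (V v))"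
      by (simp add: r_def algebra_simps)
  qed (use K L A B M in simp)
qed

text \<open>The minimum may fail to be differentiable where several components are active, but its
  increment from \<open>u\<close> to \<open>v\<close> is at most that of a component minimal at
  \<open>u\<close>. A sign condition on the derivatives of the active components is therefore enough
  for the increment criterion.\<close>

lemma Min_decreasing_of_absolutely_continuous:
  fixes V :: "real \<Rightarrow> 'a::metric_space" and g :: "'i::finite \<Rightarrow> real \<Rightarrow> real"
  assumes ab: "a \<le> b" and ac: "absolutely_continuous_on {a..b} V"
    and lip: "\<And>i. lipschitz_along V {a..b} (g i)"
    and ae: "AE t in lborel. t \<in> {a..b} \<longrightarrow> (\<forall>i. \<exists>d. (g i has_real_derivative d) (at t within {a..b})
        \<and> (g i t = (MIN j. g j t) \<longrightarrow> d \<le> 0))"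
  shows "(MIN i. g i b) \<le> (MIN i. g i a)"
proof -
  have Min_le: "(MIN j. g j t) \<le> g i t" for i t by (rule Min_le) auto
  have Min_ex: "\<exists>i. g i t = (MIN j. g j t)" for t
  proof -
    have "(MIN j. g j t) \<in> range (\<lambda>j. g j t)" by (rule Min_in) auto
    then show ?thesis by (metis (no_types, lifting) imageE)
  qed
  obtain K where K: "\<And>i. K i \<ge> 0" "\<And>i u v. u \<in> {a..b} \<Longrightarrow> v \<in> {a..b} \<Longrightarrow>
      norm (g i v - g i u) \<le> K i * (\<bar>v - u\<bar> + dist (V u) (V v))"
    using lip unfolding lipschitz_along_def by metis
  show ?thesis
  proof (rule decreasing_of_absolutely_continuous[OF ab ac, where K = "\<Sum>i\<in>UNIV. K i"])
    have one: "(MIN i. g i v) - (MIN i. g i u) \<le> (\<Sum>i\<in>UNIV. K i) * (\<bar>v - u\<bar> + dist (V u) (V v))"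
      if uv: "u \<in> {a..b}" "v \<in> {a..b}" for u v
    proof -
      obtain i where i: "g i u = (MIN j. g j u)" using Min_ex by blast
      have "(MIN i. g i v) - (MIN i. g i u) \<le> norm (g i v - g i u)"
        using Min_le[of v i] i unfolding real_norm_def by linarith
      also have "\<dots> \<le> K i * (\<bar>v - u\<bar> + dist (V u) (V v))" by (rule K(2)[OF uv])
      also have "\<dots> \<le> (\<Sum>i\<in>UNIV. K i) * (\<bar>v - u\<bar> + dist (V u) (V v))"
        using K(1) by (intro mult_right_mono member_le_sum) auto
      finally show ?thesis .
    qed
    show "\<bar>(MIN i. g i v) - (MIN i. g i u)\<bar> \<le> (\<Sum>i\<in>UNIV. K i) * (\<bar>v - u\<bar> + dist (V u) (V v))"
      if uv: "u \<in> {a..b}" "v \<in> {a..b}" for u v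
      using one[OF uv] one[OF uv(2,1)] by (simp add: dist_commute abs_minus_commute abs_le_iff)
    show "AE t in lborel. t \<in> {a..b} \<longrightarrow> (\<forall>e>0. \<exists>d>0. \<forall>u v. a \<le> u \<longrightarrow> u \<le> t \<longrightarrow> t \<le> v \<longrightarrow>
        v \<le> b \<longrightarrow> v - u < d \<longrightarrow> (MIN i. g i v) - (MIN i. g i u) \<le> e * (v - u))"
      using ae
    proof (rule AE_mp, intro AE_I2 impI allI)
      fix t e :: real
      assume "t \<in> {a..b} \<longrightarrow> (\<forall>i. \<exists>d. (g i has_real_derivative d) (at t within {a..b})
        \<and> (g i t = (MIN j. g j t) \<longrightarrow> d \<le> 0))" and t: "t \<in> {a..b}" and e: "e > 0"
      then obtain D where D: "\<And>i. (g i has_real_derivative D i) (at t within {a..b})"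
        "\<And>i. g i t = (MIN j. g j t) \<Longrightarrow> D i \<le> 0" by metis
      have "\<exists>d>0. \<forall>u v. a \<le> u \<longrightarrow> u \<le> t \<longrightarrow> t \<le> v \<longrightarrow> v \<le> b \<longrightarrow> v - u < d \<longrightarrow>
          g i u = (MIN j. g j u) \<longrightarrow> g i v - g i u \<le> e * (v - u)" for i
      proof (cases "g i t = (MIN j. g j t)")
        case True
        obtain d where d: "d > 0" "\<And>y. y \<in> {a..b} \<Longrightarrow> \<bar>y - t\<bar> < d \<Longrightarrow>
            \<bar>g i y - g i t - D i * (y - t)\<bar> \<le> e * \<bar>y - t\<bar>"
          using D(1)[of i] e unfolding has_field_derivative_def has_derivative_within_alt
          by (auto simp: mult.commute)
        show ?thesis
        proof (intro exI[of _ d] conjI allI impI d)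
          fix u v assume *: "a \<le> u" "u \<le> t" "t \<le> v" "v \<le> b" "v - u < d"
          have "g i v - g i t - D i * (v - t) \<le> e * (v - t)" "- (g i u - g i t - D i * (u - t)) \<le> e * (t - u)"
            using d(2)[of v] d(2)[of u] * by (auto simp: abs_le_iff)
          then have "g i v - g i u \<le> D i * (v - u) + e * (v - u)"
            by (simp add: algebra_simps)
          also have "\<dots> \<le> e * (v - u)"
            using D(2)[OF True] * by (simp add: mult_nonpos_nonneg)
          finally show "g i v - g i u \<le> e * (v - u)" .
        qed
      next
        case False
        \<comment> \<open>A component strictly above the minimum at \<open>t\<close> stays above
          \<open>g j\<close> nearby, hence is not minimal at any nearby \<open>u\<close>, and the
          implication to be shown is vacuous.\<close>
        obtain j where j: "g j t = (MIN j. g j t)" using Min_ex by blast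
        then have "g i t - g j t > 0" using Min_le[of t i] False by linarith
        moreover have "((\<lambda>s. g i s - g j s) \<longlongrightarrow> g i t - g j t) (at t within {a..b})"
          using D(1)[of i] D(1)[of j]
          by (auto intro!: tendsto_diff simp flip: continuous_within dest: DERIV_continuous)
        ultimately have "eventually (\<lambda>s. g i s - g j s > 0) (at t within {a..b})"
          by (rule order_tendstoD(1)[rotated])
        then obtain d where d: "d > 0" "\<And>y. y \<in> {a..b} \<Longrightarrow> y \<noteq> t \<Longrightarrow> dist y t < d \<Longrightarrow> g i y - g j y > 0"
          unfolding eventually_at by metis
        show ?thesis
        proof (intro exI[of _ d] conjI allI impI d)
          fix u v assume *: "a \<le> u" "u \<le> t" "t \<le> v" "v \<le> b" "v - u < d" "g i u = (MIN j. g j u)"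
          have "g i u > g j u"
            using d(2)[of u] * \<open>g i t - g j t > 0\<close> by (cases "u = t") (auto simp: dist_real_def)
          then show "g i v - g i u \<le> e * (v - u)" using *(6) Min_le[of u j] by linarith
        qed
      qed
      then obtain d where d: "\<And>i. d i > 0" "\<And>i u v. a \<le> u \<Longrightarrow> u \<le> t \<Longrightarrow> t \<le> v \<Longrightarrow> v \<le> b \<Longrightarrow>
          v - u < d i \<Longrightarrow> g i u = (MIN j. g j u) \<Longrightarrow> g i v - g i u \<le> e * (v - u)"
        by metis
      show "\<exists>d>0. \<forall>u v. a \<le> u \<longrightarrow> u \<le> t \<longrightarrow> t \<le> v \<longrightarrow> v \<le> b \<longrightarrow> v - u < d \<longrightarrow>
          (MIN i. g i v) - (MIN i. g i u) \<le> e * (v - u)"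
      proof (intro exI[of _ "MIN i. d i"] conjI allI impI)
        show "(MIN i. d i) > 0" using d(1) by (subst Min_gr_iff) auto
        fix u v assume *: "a \<le> u" "u \<le> t" "t \<le> v" "v \<le> b" "v - u < (MIN i. d i)"
        obtain i where i: "g i u = (MIN j. g j u)" using Min_ex by blast
        have "(MIN i. d i) \<le> d i" by (rule Min.coboundedI) auto
        then show "(MIN i. g i v) - (MIN i. g i u) \<le> e * (v - u)"
          using d(2)[of u v i] * i Min_le[of v i] by linarith
      qed
    qed
  qed
qed

section \<open>Multiobjective inertial dynamics\<close>

text \<open>The adjoint of the derivative, applied to 1, is its Riesz representative; uniqueness of
  derivatives makes the description in \<open>gradient\<close> well defined.\<close>

lemma GDERIV_gradient:
  fixes f :: "'a::euclidean_space \<Rightarrow> real"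
  assumes "f differentiable (at x)"
  shows "GDERIV f x :> gradient f x"
proof -
  obtain f' where f': "(f has_derivative f') (at x)"
    using assms unfolding differentiable_def by blast
  have "f' = (\<lambda>h. inner h (adjoint f' (1::real)))"
    using adjoint_works[OF has_derivative_linear[OF f'], where y = "1::real"] by (auto simp: fun_eq_iff)
  then have D: "GDERIV f x :> adjoint f' (1::real)"
    using f' unfolding gderiv_def by metis
  have "D' = adjoint f' (1::real)" if "GDERIV f x :> D'" for D'
  proof -
    have "(\<lambda>h. inner h D') = (\<lambda>h. inner h (adjoint f' (1::real)))"
      using that D unfolding gderiv_def by (rule has_derivative_unique)
    then show ?thesis by (metis inner_commute vector_eq_rdot)
  qed
  then show ?thesis unfolding gradient_def using D by (metis theI)
qed

lemma has_real_derivative_inner: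
  fixes f g :: "real \<Rightarrow> 'a::real_inner"
  assumes "(f has_vector_derivative f') (at t within S)" "(g has_vector_derivative g') (at t within S)"
  shows "((\<lambda>t. inner (f t) (g t)) has_real_derivative inner (f t) g' + inner f' (g t)) (at t within S)"
proof -
  have "((\<lambda>t. inner (f t) (g t)) has_derivative (\<lambda>h. inner (f t) (h *\<^sub>R g') + inner (h *\<^sub>R f') (g t))) (at t within S)"
    using assms unfolding has_vector_derivative_def by (rule has_derivative_inner)
  then show ?thesis
    unfolding has_field_derivative_def
    by (rule has_derivative_eq_rhs) (auto simp: fun_eq_iff algebra_simps)
qed

text \<open>Restriction to the line through \<open>x\<close> and \<open>y\<close> reduces the claim
  to the tangent inequality for a convex function of one real variable.\<close>

lemma convex_gradient_inequality:
  fixes f :: "'a::real_inner \<Rightarrow> real"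
  assumes conv: "convex_on UNIV f" and D: "GDERIV f x :> D"
  shows "f x - f y \<le> inner D (x - y)"
proof -
  define \<phi> where "\<phi> = (\<lambda>s::real. f (x + s *\<^sub>R (y - x)))"
  have "convex_on UNIV \<phi>"
  proof (rule convex_onI)
    fix t u v :: real assume "0 < t" "t < 1"
    have "x + ((1 - t) *\<^sub>R u + t *\<^sub>R v) *\<^sub>R (y - x)
        = (1 - t) *\<^sub>R (x + u *\<^sub>R (y - x)) + t *\<^sub>R (x + v *\<^sub>R (y - x))"
      by (simp add: algebra_simps)
    then show "\<phi> ((1 - t) *\<^sub>R u + t *\<^sub>R v) \<le> (1 - t) * \<phi> u + t * \<phi> v"
      using convex_onD[OF conv, of t] \<open>0 < t\<close> \<open>t < 1\<close> unfolding \<phi>_def by simp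
  qed simp
  moreover have "(\<phi> has_real_derivative inner (y - x) D) (at 0)"
  proof -
    have "((\<lambda>s::real. x + s *\<^sub>R (y - x)) has_derivative (\<lambda>s. s *\<^sub>R (y - x))) (at 0)"
      by (auto intro!: derivative_eq_intros)
    moreover have "(f has_derivative (\<lambda>h. inner h D)) (at (x + 0 *\<^sub>R (y - x)))"
      using D by (simp add: gderiv_def)
    ultimately have "(\<phi> has_derivative (\<lambda>s. inner (s *\<^sub>R (y - x)) D)) (at 0)"
      unfolding \<phi>_def by (rule has_derivative_compose)
    then show ?thesis by (simp add: has_field_derivative_def mult.commute[of _ "inner (y - x) D"] mult_commute_abs)
  qed
  ultimately have "\<phi> 1 - \<phi> 0 \<ge> inner (y - x) D * (1 - 0)"
    by (intro convex_on_imp_above_tangent[where A = UNIV]) auto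
  then show ?thesis by (simp add: \<phi>_def inner_diff_left inner_diff_right inner_commute)
qed

lemma lipschitz_along_const: "lipschitz_along V S (\<lambda>t. c)"
  by (rule lipschitz_alongI[of 0]) auto

lemma lipschitz_along_powr:
  assumes "a > 0"
  shows "lipschitz_along V {a..b} (\<lambda>t::real. t powr r)"
proof (rule lipschitz_along_C1)
  fix t assume "t \<in> {a..b}"
  then show "((\<lambda>t. t powr r) has_vector_derivative r * t powr (r - 1)) (at t within {a..b})"
    using assms unfolding has_real_derivative_iff_has_vector_derivative[symmetric]
    by (auto intro!: derivative_eq_intros)
next
  show "continuous_on {a..b} (\<lambda>t. r * t powr (r - 1))"
    using assms by (auto intro!: continuous_intros)
qed

lemma Min_affine:
  fixes h :: "'i::finite \<Rightarrow> real"
  assumes "c \<ge> 0"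
  shows "(MIN i. c * h i + d) = c * (MIN i. h i) + d"
proof -
  have "mono (\<lambda>s. c * s + d)" using assms by (auto intro!: monoI mult_left_mono)
  then have "c * (MIN i. h i) + d = Min ((\<lambda>s. c * s + d) ` range h)"
    by (rule mono_Min_commute) auto
  then show ?thesis by (simp add: image_image)
qed

text \<open>Yields the contradictions in \<open>kinetic_small\<close> and
  \<open>energy_nonneg\<close>, where a quantity bounded from below would have to fall at least as
  fast as a multiple of \<open>- ln t\<close>.\<close>

lemma ln_multiple_unbounded:
  fixes M c :: real
  assumes "c > 0"
  obtains t where "t \<ge> T" "c * ln t > M"
proof -
  have "eventually (\<lambda>t. ln t > M / c) at_top"
    using ln_at_top by (auto simp: filterlim_at_top_dense)
  then have "eventually (\<lambda>t. t \<ge> T \<and> ln t > M / c) at_top"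
    using eventually_ge_at_top eventually_conj by blast
  then obtain t where "t \<ge> T" "ln t > M / c"
    by (auto simp: eventually_at_top_linorder)
  then show ?thesis using assms by (intro that[of t]) (auto simp: field_simps)
qed

section \<open>The setting and pointwise consequences of the inclusion\<close>

locale mits =
  fixes F :: "real ^ 'n \<Rightarrow> real ^ 'm"
    and x :: "real \<Rightarrow> real ^ 'n" and x0 :: "real ^ 'n"
    and p \<alpha> L :: real
  assumes p_nonneg: "0 \<le> p" and p_less: "p < \<alpha> - 3"
    and convex: "\<And>i. convex_on UNIV (\<lambda>y. F y $ i)"
    and below: "\<And>i. bdd_below (range (\<lambda>y. F y $ i))"
    and diff: "\<And>i y. (\<lambda>z. F z $ i) differentiable (at y)"
    and lips: "\<And>i. L-lipschitz_on UNIV (gradient (\<lambda>y. F y $ i))"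
    and sol: "mits_solution \<alpha> (\<lambda>t. t powr p) F x0 x"
begin

abbreviation V :: "real \<Rightarrow> real ^ 'n" where "V \<equiv> velocity x"

abbreviation G :: "'m \<Rightarrow> real ^ 'n \<Rightarrow> real ^ 'n" where "G i \<equiv> gradient (\<lambda>y. F y $ i)"

lemma x_deriv: "t \<ge> 1 \<Longrightarrow> (x has_vector_derivative V t) (at t within {1..})"
  using sol unfolding mits_solution_def velocity_def by (simp add: vector_derivative_works)

lemma V_cont: "continuous_on {1..} V"
  using sol unfolding mits_solution_def by blast

lemma x_cont: "continuous_on {1..} x"
  using x_deriv has_vector_derivative_continuous by (fastforce simp: continuous_on_eq_continuous_within)

lemma V_ac: "1 \<le> a \<Longrightarrow> a \<le> b \<Longrightarrow> absolutely_continuous_on {a..b} V"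
  using sol absolutely_continuous_on_subset[of "{1..b}" V "{a..b}"]
  unfolding mits_solution_def by auto

lemma G_cont: "continuous_on S (G i)"
  using lips lipschitz_on_continuous_on continuous_on_subset by blast

lemma F_GDERIV: "GDERIV (\<lambda>z. F z $ i) y :> G i y"
  by (rule GDERIV_gradient[OF diff])

lemma F_cont: "continuous_on S (\<lambda>y. F y $ i)"
  using diff by (simp add: continuous_at_imp_continuous_on differentiable_imp_continuous_within)

lemma Fx_deriv:
  assumes "t \<ge> 1"
  shows "((\<lambda>t. F (x t) $ i) has_real_derivative inner (G i (x t)) (V t)) (at t within {1..})"
proof -
  have "((\<lambda>t. F (x t) $ i) has_derivative (\<lambda>h. inner (h *\<^sub>R V t) (G i (x t)))) (at t within {1..})"
    using has_derivative_compose[OF x_deriv[OF assms, unfolded has_vector_derivative_def]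
        F_GDERIV[of i "x t", unfolded gderiv_def]] .
  then show ?thesis
    by (simp add: has_field_derivative_def inner_commute mult_commute_abs)
qed

text \<open>The projection of 0 equals \<open>- (\<alpha> / t) *\<^sub>R V t\<close> and has the
  form \<open>t powr p *\<^sub>R c + acc t\<close> with \<open>c\<close> in the hull, which gives
  the differential equation. The obtuse angle property of the projection, tested against each vertex
  \<open>G i (x t)\<close>, gives the inequalities, because \<open>\<alpha> / t\<close> and
  \<open>t powr p\<close> are positive.\<close>

lemma mits_ae:
  "AE t in lborel. 1 \<le> t \<longrightarrow> (\<exists>c. (V has_vector_derivative (- (\<alpha> / t) *\<^sub>R V t - t powr p *\<^sub>R c)) (at t within {1..})
     \<and> c \<in> grad_hull F (x t) \<and> (\<forall>i. inner (G i (x t)) (V t) \<le> inner c (V t)))"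
proof -
  obtain acc where acc: "AE t in lborel. 1 \<le> t \<longrightarrow>
        (V has_vector_derivative acc t) (at t within {1..}) \<and>
        (\<alpha> / t) *\<^sub>R V t + closest_point ((\<lambda>c. t powr p *\<^sub>R c + acc t) ` grad_hull F (x t)) 0 = 0"
    using sol unfolding mits_solution_def by blast
  show ?thesis
    using acc
  proof (rule AE_mp, intro AE_I2 impI)
    fix t :: real
    define S where "S = (\<lambda>c. t powr p *\<^sub>R c + acc t) ` grad_hull F (x t)"
    assume "1 \<le> t \<longrightarrow> (V has_vector_derivative acc t) (at t within {1..}) \<and>
        (\<alpha> / t) *\<^sub>R V t + closest_point ((\<lambda>c. t powr p *\<^sub>R c + acc t) ` grad_hull F (x t)) 0 = 0" and t: "1 \<le> t"
    then have d: "(V has_vector_derivative acc t) (at t within {1..})"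
      and pr: "(\<alpha> / t) *\<^sub>R V t + closest_point S 0 = 0"
      by (auto simp: S_def)
    have hull: "compact (grad_hull F (x t))" "convex (grad_hull F (x t))" "grad_hull F (x t) \<noteq> {}"
      by (auto simp: grad_hull_def finite_imp_compact_convex_hull)
    have S: "closed S" "convex S" "S \<noteq> {}"
      using hull convex_affinity[OF hull(2), of "acc t" "t powr p"] unfolding S_def
      by (auto intro!: compact_imp_closed compact_continuous_image continuous_intros
          simp: add.commute)
    have cp: "closest_point S 0 = - (\<alpha> / t) *\<^sub>R V t"
      using pr by (simp add: eq_neg_iff_add_eq_0 add.commute)
    obtain c where c: "c \<in> grad_hull F (x t)" "closest_point S 0 = t powr p *\<^sub>R c + acc t"
      using closest_point_in_set[OF S(1,3), of 0] unfolding S_def by blast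
    have a: "acc t = - (\<alpha> / t) *\<^sub>R V t - t powr p *\<^sub>R c"
      using c(2) cp by (simp add: algebra_simps)
    have "inner (G i (x t)) (V t) \<le> inner c (V t)" for i
    proof -
      have "G i (x t) \<in> grad_hull F (x t)"
        by (auto simp: grad_hull_def intro: hull_inc)
      then have "inner (0 - closest_point S 0) (t powr p *\<^sub>R G i (x t) + acc t - closest_point S 0) \<le> 0"
        by (intro closest_point_dot S) (auto simp: S_def)
      then have "(\<alpha> / t) * (t powr p * inner (V t) (G i (x t) - c)) \<le> 0"
        using c(2) unfolding cp by (simp add: a inner_diff_right inner_add_right algebra_simps)
      moreover have "\<alpha> / t > 0" "t powr p > 0" using t p_nonneg p_less by auto
      ultimately have "inner (V t) (G i (x t) - c) \<le> 0"
        by (metis mult_pos_pos not_less)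
      then show ?thesis by (simp add: inner_diff_right inner_commute)
    qed
    then show "\<exists>c. (V has_vector_derivative (- (\<alpha> / t) *\<^sub>R V t - t powr p *\<^sub>R c)) (at t within {1..})
     \<and> c \<in> grad_hull F (x t) \<and> (\<forall>i. inner (G i (x t)) (V t) \<le> inner c (V t))"
      using c d a by auto
  qed
qed

text \<open>The vectors satisfying the bound form a half-space, so it suffices to check the
  generators of the hull, where it is the gradient inequality for convex functions.\<close>

lemma grad_hull_inequality:
  assumes "c \<in> grad_hull F (x t)"
  shows "(MIN i. F (x t) $ i - F z $ i) \<le> inner c (x t - z)"
proof -
  let ?m = "MIN i. F (x t) $ i - F z $ i"
  have "grad_hull F (x t) \<subseteq> {c. inner (x t - z) c \<ge> ?m}"
    unfolding grad_hull_def
  proof (rule hull_minimal)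
    have "?m \<le> inner (x t - z) (G i (x t))" for i
    proof -
      have "?m \<le> F (x t) $ i - F z $ i" by (rule Min_le) auto
      also have "\<dots> \<le> inner (G i (x t)) (x t - z)"
        by (rule convex_gradient_inequality[OF convex F_GDERIV])
      finally show ?thesis by (simp add: inner_commute)
    qed
    then show "range (\<lambda>i. G i (x t)) \<subseteq> {c. ?m \<le> inner (x t - z) c}" by blast
  qed (rule convex_halfspace_ge)
  then show ?thesis using assms by (auto simp: inner_commute)
qed

section \<open>Lipschitz bounds for the ingredients of the energies\<close>

lemma lip_V: "lipschitz_along V S V"
  by (rule lipschitz_along_self)

lemma lip_mult:
  fixes f g :: "real \<Rightarrow> real"
  assumes "1 \<le> a" "lipschitz_along V {a..b} f" "lipschitz_along V {a..b} g"
  shows "lipschitz_along V {a..b} (\<lambda>t. f t * g t)"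
proof (rule lipschitz_along_bilinear[OF bounded_bilinear_mult assms(2,3)])
  show "bounded (V ` {a..b})"
    using assms(1) by (intro compact_imp_bounded compact_continuous_image continuous_on_subset[OF V_cont]) auto
qed simp

lemma lip_inner:
  fixes f g :: "real \<Rightarrow> real ^ 'n"
  assumes "1 \<le> a" "lipschitz_along V {a..b} f" "lipschitz_along V {a..b} g"
  shows "lipschitz_along V {a..b} (\<lambda>t. inner (f t) (g t))"
proof (rule lipschitz_along_bilinear[OF bounded_bilinear_inner assms(2,3)])
  show "bounded (V ` {a..b})"
    using assms(1) by (intro compact_imp_bounded compact_continuous_image continuous_on_subset[OF V_cont]) auto
qed simp

lemma lip_x:
  assumes "1 \<le> a"
  shows "lipschitz_along V {a..b} (\<lambda>t. x t - z)"
proof (rule lipschitz_along_C1)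
  show "((\<lambda>t. x t - z) has_vector_derivative V t) (at t within {a..b})" if "t \<in> {a..b}" for t
    using that assms x_deriv[of t]
    by (auto intro!: derivative_eq_intros intro: has_vector_derivative_within_subset)
  show "continuous_on {a..b} V"
    using assms by (intro continuous_on_subset[OF V_cont]) auto
qed

lemma lip_F:
  assumes "1 \<le> a"
  shows "lipschitz_along V {a..b} (\<lambda>t. F (x t) $ i - d)"
proof (rule lipschitz_along_C1)
  show "((\<lambda>t. F (x t) $ i - d) has_vector_derivative inner (G i (x t)) (V t)) (at t within {a..b})"
    if "t \<in> {a..b}" for t
  proof -
    have "((\<lambda>t. F (x t) $ i) has_real_derivative inner (G i (x t)) (V t)) (at t within {a..b})"
      using that assms by (intro DERIV_subset[OF Fx_deriv]) auto
    then show ?thesis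
      unfolding has_real_derivative_iff_has_vector_derivative[symmetric]
      by (auto intro!: derivative_eq_intros)
  qed
  have "continuous_on {a..b} V" "continuous_on {a..b} x"
    using assms by (auto intro!: continuous_on_subset[OF V_cont] continuous_on_subset[OF x_cont])
  then show "continuous_on {a..b} (\<lambda>t. inner (G i (x t)) (V t))"
    by (intro continuous_on_inner continuous_on_compose2[OF G_cont[of UNIV]]) auto
qed

lemma lip_ln:
  assumes "1 \<le> a"
  shows "lipschitz_along V {a..b} (\<lambda>t. ln t :: real)"
proof (rule lipschitz_along_C1)
  show "(ln has_vector_derivative inverse t) (at t within {a..b})" if "t \<in> {a..b}" for t :: real
    using that assms unfolding has_real_derivative_iff_has_vector_derivative[symmetric]
    by (auto intro!: derivative_eq_intros simp: field_simps)
  show "continuous_on {a..b} (inverse :: real \<Rightarrow> real)"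
    using assms by (auto intro!: continuous_intros)
qed

lemma lip_id: "lipschitz_along V S (\<lambda>t. t :: real)"
  by (rule lipschitz_alongI[of 1]) auto

section \<open>Dissipation of the individual objectives\<close>

text \<open>The potential and kinetic parts contribute \<open>inner (G i (x t) - q) (V t)\<close>,
  which is nonpositive by \<open>mits_ae\<close>. The damping contributes
  \<open>- \<alpha> * inner (V t) (V t) * t powr (- p) / t\<close>, which absorbs the derivative
  \<open>c / t\<close> of the logarithmic term. The choice \<open>c = 0\<close> gives monotonicity,
  a positive \<open>c\<close> a quantitative loss.\<close>

lemma decrease_component:
  assumes ab: "1 \<le> a" "a \<le> b"
    and c: "\<And>t. t \<in> {a..b} \<Longrightarrow> c \<le> \<alpha> * inner (V t) (V t) * t powr (- p)"
  shows "F (x b) $ i + inner (V b) (V b) * b powr (- p) / 2 + c * ln b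
    \<le> F (x a) $ i + inner (V a) (V a) * a powr (- p) / 2 + c * ln a"
proof -
  \<comment> \<open>The one-element index type makes the criterion for minima applicable to a single
    function.\<close>
  define g where "g = (\<lambda>(_::unit) t. (F (x t) $ i - 0) + (1 / 2) * (inner (V t) (V t) * t powr (- p)) + c * ln t)"
  have "(MIN k. g k b) \<le> (MIN k. g k a)"
  proof (rule Min_decreasing_of_absolutely_continuous[OF ab(2) V_ac[OF ab]])
    show "lipschitz_along V {a..b} (g k)" for k
      unfolding g_def using ab
      by (intro lipschitz_along_add lip_mult lip_inner lip_V lip_F lip_ln lipschitz_along_const lipschitz_along_powr) auto
    show "AE t in lborel. t \<in> {a..b} \<longrightarrow> (\<forall>k. \<exists>d. (g k has_real_derivative d) (at t within {a..b})
        \<and> (g k t = (MIN j. g j t) \<longrightarrow> d \<le> 0))"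
      using mits_ae
    proof (rule AE_mp, intro AE_I2 impI allI)
      fix t k
      assume *: "1 \<le> t \<longrightarrow> (\<exists>c. (V has_vector_derivative (- (\<alpha> / t) *\<^sub>R V t - t powr p *\<^sub>R c)) (at t within {1..})
         \<and> c \<in> grad_hull F (x t) \<and> (\<forall>i. inner (G i (x t)) (V t) \<le> inner c (V t)))" and t: "t \<in> {a..b}"
      have t1: "1 \<le> t" using t ab by auto
      obtain q where q: "(V has_vector_derivative (- (\<alpha> / t) *\<^sub>R V t - t powr p *\<^sub>R q)) (at t within {1..})"
        "\<And>i. inner (G i (x t)) (V t) \<le> inner q (V t)"
        using * t1 by blast
      have sub: "{a..b} \<subseteq> {1..}" using ab by auto
      let ?v = "inner (V t) (V t)"
      define w where "w = - (\<alpha> / t) *\<^sub>R V t - t powr p *\<^sub>R q"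
      have dv: "(V has_vector_derivative w) (at t within {a..b})"
        unfolding w_def by (rule has_vector_derivative_within_subset[OF q(1) sub])
      have dV: "((\<lambda>t. inner (V t) (V t)) has_real_derivative 2 * inner (V t) w) (at t within {a..b})"
        using has_real_derivative_inner[OF dv dv] by (simp add: inner_commute)
      have dF: "((\<lambda>t. F (x t) $ i) has_real_derivative inner (G i (x t)) (V t)) (at t within {a..b})"
        by (rule DERIV_subset[OF Fx_deriv[OF t1] sub])
      let ?d = "inner (G i (x t)) (V t) + (1 / 2) * (2 * inner (V t) w * t powr (- p)
          + ?v * (- p * t powr (- p - 1))) + c / t"
      have "(g k has_real_derivative ?d) (at t within {a..b})"
        unfolding g_def using t1
        by (auto intro!: derivative_eq_intros dV dF simp: field_simps)
      moreover have "?d \<le> 0"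
      proof -
        have pp: "t powr (- p) * t powr p = 1" using t1 by (simp flip: powr_add)
        have "inner (V t) w * t powr (- p) = - (\<alpha> / t) * ?v * t powr (- p) - inner q (V t) * (t powr (- p) * t powr p)"
          unfolding w_def by (simp add: inner_diff_right inner_commute algebra_simps)
        then have e: "inner (V t) w * t powr (- p) = - ((\<alpha> * ?v * t powr (- p)) / t) - inner q (V t)"
          unfolding pp by simp
        have "?v * (- p * t powr (- p - 1)) \<le> 0"
          using p_nonneg by (simp add: mult_nonneg_nonneg)
        moreover have "c / t \<le> (\<alpha> * ?v * t powr (- p)) / t"
          using c[OF t] t1 by (intro divide_right_mono) auto
        moreover have "?d = inner (G i (x t)) (V t) + inner (V t) w * t powr (- p)
            + ?v * (- p * t powr (- p - 1)) / 2 + c / t" by simp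
        ultimately show ?thesis using e q(2)[of i] by linarith
      qed
      ultimately show "\<exists>d. (g k has_real_derivative d) (at t within {a..b})
        \<and> (g k t = (MIN j. g j t) \<longrightarrow> d \<le> 0)" by blast
    qed
  qed
  then show ?thesis by (simp add: g_def)
qed

section \<open>The energy and its decrease\<close>

definition \<eta> :: real where "\<eta> = (\<alpha> - 3 - p) / 2"
definition \<Lambda> :: real where "\<Lambda> = 2 + p + \<eta>"

text \<open>Splitting the gap \<open>\<alpha> - 3 - p\<close> into equal halves leaves the same
  margin twice: in the derivative of the energy the coefficient of
  \<open>t powr (1 + p) * \<sigma> z t\<close> is \<open>2 + p - \<Lambda> = - \<eta>\<close>, and
  that of \<open>t * inner (V t) (V t)\<close> is
  \<open>\<Lambda> - (\<alpha> - 1) = - \<eta>\<close>.\<close>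

lemma \<eta>_pos: "\<eta> > 0" and \<Lambda>_pos: "\<Lambda> > 0" and \<alpha>_eq: "\<alpha> - 1 = \<Lambda> + \<eta>"
  using p_less p_nonneg by (auto simp: \<eta>_def \<Lambda>_def field_simps)

text \<open>The squares of the energy are expanded here; the coefficient of \<open>|x - z|\<^sup>2 / 2\<close> is
  \<open>\<Lambda>\<^sup>2 + \<Lambda> \<eta> = \<Lambda> (\<alpha> - 1)\<close>.\<close>

definition component_energy :: "real ^ 'n \<Rightarrow> 'm \<Rightarrow> real \<Rightarrow> real" where
  "component_energy z i t = t powr (2 + p) * (F (x t) $ i - F z $ i)
     + (1 / 2) * (t * t * inner (V t) (V t)) + \<Lambda> * (t * inner (x t - z) (V t))
     + (\<Lambda> * (\<alpha> - 1) / 2) * inner (x t - z) (x t - z)"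

definition energy :: "real ^ 'n \<Rightarrow> real \<Rightarrow> real" where
  "energy z t = (MIN i. component_energy z i t)"

abbreviation W :: "real ^ 'n \<Rightarrow> real \<Rightarrow> real" where "W \<equiv> energy_W p F x"

abbreviation \<sigma> :: "real ^ 'n \<Rightarrow> real \<Rightarrow> real" where "\<sigma> z t \<equiv> (MIN i. F (x t) $ i - F z $ i)"

text \<open>Only the first summand depends on \<open>i\<close>, with positive weight, so a component
  minimal for the energy also attains \<open>\<sigma> z t\<close>. This brings the bound for the
  hull into play at active indices; \<open>d\<close> makes room for the linear term added in
  \<open>energy_decrease\<close>.\<close>

lemma component_energy_active:
  assumes "1 \<le> t" "component_energy z i t + d = (MIN j. component_energy z j t + d)"
  shows "F (x t) $ i - F z $ i = \<sigma> z t"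
proof -
  have "component_energy z i t + d \<le> component_energy z j t + d" for j
    unfolding assms(2) by (rule Min_le) auto
  then have "F (x t) $ i - F z $ i \<le> F (x t) $ j - F z $ j" for j
    using assms(1) by (simp add: component_energy_def)
  then have "\<sigma> z t = F (x t) $ i - F z $ i"
    by (intro Min_eqI) auto
  then show ?thesis by simp
qed

lemma powr_W:
  assumes "t \<ge> 1"
  shows "t powr (q + p) * W z t = t powr (q + p) * \<sigma> z t + t powr q * inner (V t) (V t) / 2"
  using assms by (simp add: energy_W_def distrib_left power2_norm_eq_inner powr_add)

lemma energy_eq:
  assumes "t \<ge> 1"
  shows "energy z t = t powr (2 + p) * W z t + \<Lambda> * (t * inner (x t - z) (V t))
    + (\<Lambda> * (\<alpha> - 1) / 2) * inner (x t - z) (x t - z)"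
proof -
  have "energy z t = t powr (2 + p) * \<sigma> z t + ((1 / 2) * (t * t * inner (V t) (V t))
      + \<Lambda> * (t * inner (x t - z) (V t)) + (\<Lambda> * (\<alpha> - 1) / 2) * inner (x t - z) (x t - z))"
    unfolding energy_def component_energy_def add.assoc by (rule Min_affine) simp
  moreover have "t powr 2 = t * t" using assms by (simp add: powr_numeral power2_eq_square)
  ultimately show ?thesis using powr_W[OF assms, of 2 z] by simp
qed

text \<open>An integrated form of the differential inequality for the energy: a constant lower bound
  \<open>c\<close> of the dissipation on \<open>{a..b}\<close> is added as a linear function, so
  that no integral of \<open>W\<close> has to be formed.\<close>

lemma energy_decrease:
  assumes ab: "1 \<le> a" "a \<le> b"
    and c: "\<And>t. t \<in> {a..b} \<Longrightarrow> c \<le> \<eta> * (t powr (1 + p) * W z t)"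
  shows "energy z b + c * (b - a) \<le> energy z a"
proof -
  define g where "g = (\<lambda>i t. component_energy z i t + c * t)"
  have "(MIN i. g i b) \<le> (MIN i. g i a)"
  proof (rule Min_decreasing_of_absolutely_continuous[OF ab(2) V_ac[OF ab]])
    show "lipschitz_along V {a..b} (g i)" for i
      unfolding g_def component_energy_def using ab
      by (intro lipschitz_along_add lip_mult lip_inner lip_V lip_F lip_x lip_id lipschitz_along_const lipschitz_along_powr) auto
    show "AE t in lborel. t \<in> {a..b} \<longrightarrow> (\<forall>i. \<exists>d. (g i has_real_derivative d) (at t within {a..b})
        \<and> (g i t = (MIN j. g j t) \<longrightarrow> d \<le> 0))"
      using mits_ae
    proof (rule AE_mp, intro AE_I2 impI allI)
      fix t i
      assume *: "1 \<le> t \<longrightarrow> (\<exists>c. (V has_vector_derivative (- (\<alpha> / t) *\<^sub>R V t - t powr p *\<^sub>R c)) (at t within {1..})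
         \<and> c \<in> grad_hull F (x t) \<and> (\<forall>i. inner (G i (x t)) (V t) \<le> inner c (V t)))" and t: "t \<in> {a..b}"
      have t1: "1 \<le> t" using t ab by auto
      obtain q where q: "(V has_vector_derivative (- (\<alpha> / t) *\<^sub>R V t - t powr p *\<^sub>R q)) (at t within {1..})"
        "q \<in> grad_hull F (x t)" "\<And>i. inner (G i (x t)) (V t) \<le> inner q (V t)"
        using * t1 by blast
      have sub: "{a..b} \<subseteq> {1..}" using ab by auto
      define w where "w = - (\<alpha> / t) *\<^sub>R V t - t powr p *\<^sub>R q"
      define v where "v = inner (V t) (V t)"
      define y where "y = x t - z"
      define s where "s = F (x t) $ i - F z $ i"
      have dv: "(V has_vector_derivative w) (at t within {a..b})"
        unfolding w_def by (rule has_vector_derivative_within_subset[OF q(1) sub])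
      have dy: "((\<lambda>t. x t - z) has_vector_derivative V t) (at t within {a..b})"
        using has_vector_derivative_within_subset[OF x_deriv[OF t1] sub]
        by (auto intro!: derivative_eq_intros)
      have dV: "((\<lambda>t. inner (V t) (V t)) has_real_derivative 2 * inner (V t) w) (at t within {a..b})"
        using has_real_derivative_inner[OF dv dv] by (simp add: inner_commute)
      have dyV: "((\<lambda>t. inner (x t - z) (V t)) has_real_derivative v + inner y w) (at t within {a..b})"
        using has_real_derivative_inner[OF dy dv] by (simp add: v_def y_def add.commute)
      have dyy: "((\<lambda>t. inner (x t - z) (x t - z)) has_real_derivative 2 * inner y (V t)) (at t within {a..b})"
        using has_real_derivative_inner[OF dy dy] by (simp add: y_def inner_commute)
      have dF: "((\<lambda>t. F (x t) $ i) has_real_derivative inner (G i (x t)) (V t)) (at t within {a..b})"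
        by (rule DERIV_subset[OF Fx_deriv[OF t1] sub])
      have d1: "((\<lambda>t. t powr (2 + p)) has_real_derivative (2 + p) * t powr (1 + p)) (at t within {a..b})"
        using t1 by (auto intro!: derivative_eq_intros)
      have d2: "((\<lambda>t. t) has_real_derivative 1) (at t within {a..b})" by (rule DERIV_ident)
      have dF0: "((\<lambda>t. F (x t) $ i - F z $ i) has_real_derivative inner (G i (x t)) (V t)) (at t within {a..b})"
        using DERIV_diff[OF dF DERIV_const] by simp
      \<comment> \<open>Written in the shape in which the product rule delivers it; the
        simplification follows separately.\<close>
      define d where "d = ((2 + p) * t powr (1 + p)) * s + inner (G i (x t)) (V t) * t powr (2 + p)
          + (1 / 2) * ((1 * t + 1 * t) * v + 2 * inner (V t) w * (t * t))
          + \<Lambda> * (1 * inner y (V t) + (v + inner y w) * t) + (\<Lambda> * (\<alpha> - 1) / 2) * (2 * inner y (V t)) + c * 1"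
      have "(g i has_real_derivative d) (at t within {a..b})"
        unfolding g_def component_energy_def d_def s_def v_def y_def
        by (intro DERIV_add DERIV_cmult DERIV_mult d1 d2 dF0 dV dyV[unfolded v_def y_def] dyy[unfolded y_def])
      moreover have "d \<le> 0" if "g i t = (MIN j. g j t)"
      proof -
        have s: "s = \<sigma> z t"
          using component_energy_active[OF t1] that unfolding g_def s_def by blast
        have tp: "t powr (1 + p) = t * t powr p" "t powr (2 + p) = t * (t * t powr p)"
          using t1 by (simp_all add: powr_add powr_numeral power2_eq_square)
        have T2: "t powr (2 + p) = t * t powr (1 + p)" by (simp add: tp)
        \<comment> \<open>Here \<open>al\<close>, \<open>l\<close>, \<open>e\<close> stand for
          \<alpha>, \<Lambda>, \<eta>. The terms in \<open>b\<close>, the inner product of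
          \<open>x t - z\<close> and \<open>V t\<close>, cancel because of the coefficient
          \<open>l * (al - 1)\<close>; the kinetic terms collapse to
          \<open>- e * t * u\<close>.\<close>
        have alg: "A + t * T * g + t * u + t * (- al * u - T * h) + l * (b + t * u + (- al * b - T * r))
            + l * (al - 1) * b + c = A + t * T * (g - h) - e * t * u - l * T * r + c"
          if "al - 1 = l + e" for A T g u h al l b r e :: real
        proof -
          have "al = l + e + 1" using that by simp
          then show ?thesis by (simp add: algebra_simps)
        qed
        have w1: "t * inner (V t) w = - \<alpha> * v - t powr (1 + p) * inner q (V t)"
          using t1 unfolding w_def v_def tp by (simp add: inner_diff_right inner_commute algebra_simps)
        have w2: "t * inner y w = - \<alpha> * inner y (V t) - t powr (1 + p) * inner q y"
          using t1 unfolding w_def tp by (simp add: inner_diff_right inner_commute algebra_simps)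
        have "d = (2 + p) * t powr (1 + p) * s + t powr (2 + p) * (inner (G i (x t)) (V t) - inner q (V t))
          - \<eta> * t * v - \<Lambda> * t powr (1 + p) * inner q y + c"
        proof -
          have "d = (2 + p) * t powr (1 + p) * s + t powr (2 + p) * inner (G i (x t)) (V t)
            + t * v + t * (t * inner (V t) w) + \<Lambda> * (inner y (V t) + t * v + t * inner y w)
            + \<Lambda> * (\<alpha> - 1) * inner y (V t) + c"
            unfolding d_def by (simp add: field_simps)
          then show ?thesis unfolding w1 w2 T2 by (subst alg[OF \<alpha>_eq, symmetric])
        qed
        \<comment> \<open>The projection makes the difference of inner products nonpositive, and
          convexity bounds \<open>inner q y\<close> from below by \<open>\<sigma> z t\<close>, which
          is \<open>s\<close> at an active index.\<close>
        also have "\<dots> \<le> (2 + p) * t powr (1 + p) * s + 0 - \<eta> * t * v - \<Lambda> * t powr (1 + p) * s + c"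
          using q(3)[of i] grad_hull_inequality[OF q(2), of z] \<Lambda>_pos
          unfolding s y_def by (intro add_mono diff_mono mult_left_mono order_refl mult_nonneg_nonpos) auto
        also have "\<dots> = c - \<eta> * (t powr (1 + p) * s + t * v)"
          by (simp add: \<Lambda>_def algebra_simps)
        \<comment> \<open>Only half of \<open>t * v\<close> enters the term with \<open>W\<close>;
          the other half remains with a favourable sign.\<close>
        also have "\<dots> = c - \<eta> * (t powr (1 + p) * W z t) - \<eta> * (t * v / 2)"
          using powr_W[OF t1, of 1 z] t1 by (simp add: s v_def algebra_simps)
        also have "\<dots> \<le> 0"
        proof -
          have "0 \<le> \<eta> * (t * v / 2)" using \<eta>_pos t1 by (simp add: v_def)
          then show ?thesis using c[OF t] by linarith
        qed
        finally show ?thesis .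
      qed
      ultimately show "\<exists>d. (g i has_real_derivative d) (at t within {a..b})
        \<and> (g i t = (MIN j. g j t) \<longrightarrow> d \<le> 0)" by blast
    qed
  qed
  moreover have "(MIN i. g i t) = energy z t + c * t" for t
    unfolding g_def energy_def using Min_affine[of 1 "\<lambda>i. component_energy z i t" "c * t"] by simp
  ultimately show ?thesis by (simp add: algebra_simps)
qed

text \<open>Completing the square undoes the expansion: by \<open>\<alpha>_eq\<close> the quadratic
  terms are half the squared norm of \<open>\<Lambda> *\<^sub>R (x t - z) + t *\<^sub>R V t\<close>
  plus a nonnegative multiple of the squared norm of \<open>x t - z\<close>.\<close>

lemma energy_nonneg_of_sigma_nonneg:
  assumes "t \<ge> 1" "\<sigma> z t \<ge> 0"
  shows "energy z t \<ge> 0"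
proof -
  let ?y = "x t - z"
  have alg: "A + r / 2 + \<Lambda> * b + (\<Lambda> * (\<Lambda> + \<eta>) / 2) * y
    = A + (\<Lambda> * \<eta> / 2) * y + (\<Lambda> * \<Lambda> * y + 2 * \<Lambda> * b + r) / 2" for A r b y :: real
    by (simp add: field_simps)
  have "0 \<le> inner (\<Lambda> *\<^sub>R ?y + t *\<^sub>R V t) (\<Lambda> *\<^sub>R ?y + t *\<^sub>R V t)" by (rule inner_ge_zero)
  also have "\<dots> = \<Lambda> * \<Lambda> * inner ?y ?y + 2 * \<Lambda> * (t * inner ?y (V t)) + t * t * inner (V t) (V t)"
    by (simp add: inner_add_left inner_add_right inner_commute algebra_simps)
  finally have "0 \<le> \<Lambda> * \<Lambda> * inner ?y ?y + 2 * \<Lambda> * (t * inner ?y (V t)) + t * t * inner (V t) (V t)" .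
  moreover have "energy z t = t powr (2 + p) * \<sigma> z t + t * t * inner (V t) (V t) / 2
      + \<Lambda> * (t * inner ?y (V t)) + (\<Lambda> * (\<alpha> - 1) / 2) * inner ?y ?y"
    using powr_W[OF assms(1), of 2 z] assms(1)
    by (simp add: energy_eq powr_numeral power2_eq_square)
  then have "energy z t = t powr (2 + p) * \<sigma> z t + (\<Lambda> * \<eta> / 2) * inner ?y ?y
      + (\<Lambda> * \<Lambda> * inner ?y ?y + 2 * \<Lambda> * (t * inner ?y (V t)) + t * t * inner (V t) (V t)) / 2"
    unfolding \<alpha>_eq by (rule trans) (rule alg)
  ultimately show ?thesis using assms(2) \<Lambda>_pos \<eta>_pos by simp
qed

section \<open>A cluster point with nonnegative W\<close>

text \<open>If the scaled kinetic term stayed above \<epsilon>, every objective together with its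
  kinetic term would lose at least \<open>\<alpha> * \<epsilon> * ln t\<close> up to a constant,
  against boundedness from below. A single index \<open>i\<close> already gives the
  contradiction.\<close>

lemma kinetic_small:
  assumes "\<epsilon> > 0"
  shows "\<exists>t\<ge>T. t \<ge> 1 \<and> inner (V t) (V t) * t powr (- p) < \<epsilon>"
proof (rule ccontr)
  assume none: "\<not> ?thesis"
  define a where "a = max T 1"
  have big: "inner (V t) (V t) * t powr (- p) \<ge> \<epsilon>" if "t \<ge> a" for t
    using that none by (auto simp: a_def not_less)
  fix i :: 'm
  have \<alpha>: "\<alpha> > 0" using p_nonneg p_less by simp
  obtain m where m: "\<And>y. m \<le> F y $ i"
    using below[of i] by (auto simp: bdd_below_def)
  let ?A = "F (x a) $ i + inner (V a) (V a) * a powr (- p) / 2 + \<alpha> * \<epsilon> * ln a"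
  obtain b where b: "b \<ge> a" "\<alpha> * \<epsilon> * ln b > ?A - m"
    using ln_multiple_unbounded[of "\<alpha> * \<epsilon>"] \<alpha> assms by (metis mult_pos_pos)
  have "F (x b) $ i + inner (V b) (V b) * b powr (- p) / 2 + \<alpha> * \<epsilon> * ln b \<le> ?A"
  proof (rule decrease_component)
    show "\<alpha> * \<epsilon> \<le> \<alpha> * inner (V t) (V t) * t powr (- p)" if "t \<in> {a..b}" for t
      using big[of t] that \<alpha> by (simp add: mult.assoc)
  qed (use b in \<open>auto simp: a_def\<close>)
  moreover have "0 \<le> inner (V b) (V b) * b powr (- p) / 2" by simp
  ultimately show False using m[of "x b"] b(2) by linarith
qed

lemma component_decreasing:
  assumes "1 \<le> a" "a \<le> b"
  shows "F (x b) $ i + inner (V b) (V b) * b powr (- p) / 2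
    \<le> F (x a) $ i + inner (V a) (V a) * a powr (- p) / 2"
  using decrease_component[OF assms, of 0 i] p_nonneg p_less by simp

text \<open>With the kinetic term inside the minimum, \<open>W\<close> is a minimum of functions to
  which \<open>component_decreasing\<close> applies, which none of the bare objectives is known to
  satisfy.\<close>

lemma W_eq:
  assumes "t \<ge> 1"
  shows "W z t = (MIN i. (F (x t) $ i + inner (V t) (V t) * t powr (- p) / 2) - F z $ i)"
proof -
  have "(MIN i. 1 * (F (x t) $ i - F z $ i) + inner (V t) (V t) * t powr (- p) / 2)
      = 1 * \<sigma> z t + inner (V t) (V t) * t powr (- p) / 2"
    by (rule Min_affine) simp
  then show ?thesis
    by (simp add: energy_W_def power2_norm_eq_inner powr_minus field_simps)
qed

lemma W_decreasing:
  assumes "1 \<le> a" "a \<le> b"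
  shows "W z b \<le> W z a"
proof -
  have "(MIN i. (F (x b) $ i + inner (V b) (V b) * b powr (- p) / 2) - F z $ i)
      \<le> (F (x a) $ i + inner (V a) (V a) * a powr (- p) / 2) - F z $ i" for i
  proof -
    have "(MIN i. (F (x b) $ i + inner (V b) (V b) * b powr (- p) / 2) - F z $ i)
      \<le> (F (x b) $ i + inner (V b) (V b) * b powr (- p) / 2) - F z $ i"
      by (rule Min_le) auto
    then show ?thesis using component_decreasing[OF assms, of i] by linarith
  qed
  then show ?thesis using assms by (subst (1 2) W_eq) (auto intro!: Min.boundedI)
qed

text \<open>At the chosen times the kinetic term vanishes in the limit, so \<open>F z $ i\<close> is
  the limit of the nonincreasing component energies along the sequence and bounds them from below at
  every time.\<close>

lemma cluster_point:
  assumes "bounded (x ` {1..})"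
  obtains z s where "filterlim s at_top sequentially" "\<And>n. s n \<ge> 1" "(\<lambda>n. x (s n)) \<longlonglongrightarrow> z"
    "\<And>t. t \<ge> 1 \<Longrightarrow> W z t \<ge> 0"
proof -
  have "\<exists>t. t \<ge> real n \<and> t \<ge> 1 \<and> inner (V t) (V t) * t powr (- p) < inverse (real (Suc n))" for n
    by (rule kinetic_small) simp
  then obtain u where u: "\<And>n. u n \<ge> real n" "\<And>n. u n \<ge> 1"
    "\<And>n. inner (V (u n)) (V (u n)) * u n powr (- p) < inverse (real (Suc n))" by metis
  have "bounded (range (\<lambda>n. x (u n)))"
    using u(2) by (intro bounded_subset[OF assms]) auto
  then obtain z r where r: "strict_mono r" "((\<lambda>n. x (u n)) \<circ> r) \<longlonglongrightarrow> z"
    using bounded_imp_convergent_subsequence by blast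
  define s where "s = (\<lambda>n. u (r n))"
  have "filterlim u at_top sequentially"
    using u(1) by (intro filterlim_at_top_mono[OF filterlim_real_sequentially]) auto
  then have s_top: "filterlim s at_top sequentially"
    unfolding s_def using filterlim_subseq[OF r(1)] by (rule filterlim_compose)
  have s1: "s n \<ge> 1" for n using u(2) by (simp add: s_def)
  have sz: "(\<lambda>n. x (s n)) \<longlonglongrightarrow> z" using r(2) by (simp add: s_def o_def)
  have "(\<lambda>n. inner (V (u n)) (V (u n)) * u n powr (- p)) \<longlonglongrightarrow> 0"
  proof (rule tendsto_sandwich[OF _ _ tendsto_const LIMSEQ_inverse_real_of_nat])
    show "eventually (\<lambda>n. 0 \<le> inner (V (u n)) (V (u n)) * u n powr (- p)) sequentially" by simp
    show "eventually (\<lambda>n. inner (V (u n)) (V (u n)) * u n powr (- p) \<le> inverse (real (Suc n))) sequentially"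
      by (intro always_eventually allI less_imp_le u(3))
  qed
  from LIMSEQ_subseq_LIMSEQ[OF this r(1)]
  have k0: "(\<lambda>n. inner (V (s n)) (V (s n)) * s n powr (- p)) \<longlonglongrightarrow> 0"
    by (simp add: s_def o_def)
  have "F z $ i \<le> F (x t) $ i + inner (V t) (V t) * t powr (- p) / 2" if t: "t \<ge> 1" for t i
  proof -
    have Fs: "(\<lambda>n. F (x (s n)) $ i) \<longlonglongrightarrow> F z $ i"
      using continuous_on_tendsto_compose[OF F_cont[of UNIV] sz] by auto
    have "(\<lambda>n. F (x (s n)) $ i + inner (V (s n)) (V (s n)) * s n powr (- p) / 2) \<longlonglongrightarrow> F z $ i + 0 / 2"
      by (rule tendsto_add[OF Fs tendsto_divide[OF k0 tendsto_const]]) simp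
    moreover have "eventually (\<lambda>n. F (x (s n)) $ i + inner (V (s n)) (V (s n)) * s n powr (- p) / 2
        \<le> F (x t) $ i + inner (V t) (V t) * t powr (- p) / 2) sequentially"
      using s_top[unfolded filterlim_at_top, rule_format, of t]
      by eventually_elim (rule component_decreasing[OF t])
    ultimately have "F z $ i + 0 / 2 \<le> F (x t) $ i + inner (V t) (V t) * t powr (- p) / 2"
      by (rule tendsto_upperbound) simp
    then show ?thesis by simp
  qed
  then have "W z t \<ge> 0" if "t \<ge> 1" for t
    using that by (subst W_eq) (auto intro!: Min.boundedI)
  then show ?thesis using that s_top s1 sz by blast
qed

section \<open>Convergence of the energy, the rate and the trajectory\<close>

lemma half_sq_deriv:
  assumes "t > 1"
  shows "((\<lambda>t. inner (x t - z) (x t - z) / 2) has_real_derivative inner (x t - z) (V t)) (at t)"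
proof -
  have "(x has_vector_derivative V t) (at t)"
    using x_deriv[of t] assms at_within_interior[of t "{1..}"] by simp
  then have "((\<lambda>t. x t - z) has_vector_derivative V t) (at t)"
    by (auto intro!: derivative_eq_intros)
  from DERIV_cdivide[OF has_real_derivative_inner[OF this this], of 2]
  show ?thesis by (simp add: inner_commute)
qed

lemma energy_antimono:
  assumes W: "\<And>t. t \<ge> 1 \<Longrightarrow> W z t \<ge> 0" and "1 \<le> a" "a \<le> b"
  shows "energy z b \<le> energy z a"
  using energy_decrease[OF assms(2,3), of 0 z] W \<eta>_pos assms(2) by simp

text \<open>Nonnegativity of \<open>W\<close> leaves the sign of \<open>\<sigma>\<close> open, so
  completing the square does not help. Instead a negative value would persist by monotonicity and
  drive the squared distance to \<open>z\<close> below zero at a logarithmic rate.\<close>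

lemma energy_nonneg:
  assumes W: "\<And>t. t \<ge> 1 \<Longrightarrow> W z t \<ge> 0" and T: "T \<ge> 1"
  shows "energy z T \<ge> 0"
proof (rule ccontr)
  assume "\<not> energy z T \<ge> 0"
  \<comment> \<open>The shift by 1 keeps all times beyond \<open>a\<close> above 1, where the
    derivative of the squared distance is two-sided.\<close>
  define a where "a = T + 1"
  define h where "h = (\<lambda>t. inner (x t - z) (x t - z) / 2)"
  \<comment> \<open>From time \<open>T\<close> on,
    \<open>\<Lambda> * (t * inner (x t - z) (V t))\<close> is at most \<open>energy z T\<close>, so
    \<open>h\<close> has derivative at most \<open>- m / t\<close>.\<close>
  define m where "m = - energy z T / \<Lambda>"
  have m: "m > 0" using \<open>\<not> energy z T \<ge> 0\<close> \<Lambda>_pos by (simp add: m_def divide_neg_pos)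
  have hd: "inner (x t - z) (V t) \<le> - m / t" if "t \<ge> a" for t
  proof -
    have t: "t \<ge> 1" "t \<ge> T" using that T by (auto simp: a_def)
    have "0 \<le> t powr (2 + p) * W z t" "0 \<le> (\<Lambda> * (\<alpha> - 1) / 2) * inner (x t - z) (x t - z)"
      using W[OF t(1)] \<Lambda>_pos \<eta>_pos by (simp_all add: \<alpha>_eq)
    then have "\<Lambda> * (t * inner (x t - z) (V t)) \<le> energy z T"
      using energy_eq[OF t(1), of z] energy_antimono[OF W T t(2)] by linarith
    then show ?thesis using t \<Lambda>_pos by (simp add: m_def field_simps)
  qed
  obtain b where b: "b \<ge> a" "m * ln b > h a + m * ln a"
    using ln_multiple_unbounded[OF m] by metis
  have "h b + m * ln b \<le> h a + m * ln a"
  proof (rule DERIV_nonpos_imp_nonincreasing[OF b(1)])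
    fix t assume t: "a \<le> t" "t \<le> b"
    have "((\<lambda>t. h t + m * ln t) has_real_derivative inner (x t - z) (V t) + m * (1 / t)) (at t)"
      unfolding h_def using t T by (intro DERIV_add half_sq_deriv DERIV_cmult DERIV_ln_divide) (auto simp: a_def)
    then show "\<exists>y. ((\<lambda>t. h t + m * ln t) has_real_derivative y) (at t) \<and> y \<le> 0"
      using hd[OF t(1)] by fastforce
  qed
  moreover have "h b \<ge> 0" by (simp add: h_def)
  ultimately show False using b by linarith
qed

lemma energy_convergent:
  assumes W: "\<And>t. t \<ge> 1 \<Longrightarrow> W z t \<ge> 0"
  obtains l where "(energy z \<longlongrightarrow> l) at_top"
proof
  define l where "l = (INF t\<in>{1..}. energy z t)"
  have bdd: "bdd_below (energy z ` {1..})"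
    using energy_nonneg[OF W] by (intro bdd_belowI[of _ 0]) auto
  show "(energy z \<longlongrightarrow> l) at_top"
  proof (rule decreasing_tendsto)
    show "eventually (\<lambda>t. l \<le> energy z t) at_top"
      using eventually_ge_at_top[of 1]
      by eventually_elim (auto simp: l_def intro: cINF_lower[OF bdd])
    fix e assume "l < e"
    then obtain a where a: "a \<ge> 1" "energy z a < e"
      unfolding l_def using cINF_less_iff[OF _ bdd] by auto
    show "eventually (\<lambda>t. energy z t < e) at_top"
      using eventually_ge_at_top[of a]
      by eventually_elim (use energy_antimono[OF W a(1)] a(2) in force)
  qed
qed

text \<open>On the interval from \<open>t / 2\<close> to \<open>t\<close>, \<open>W\<close> is at
  least its value at \<open>t\<close> and the weight at least its value at \<open>t / 2\<close>.
  Hence \<eta> times \<open>(t / 2) powr (2 + p) * W z t\<close> is at most the energy lost there,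
  which tends to 0; the factor \<open>2 powr (2 + p)\<close> rescales to \<open>t\<close>.\<close>

lemma W_rate:
  assumes W: "\<And>t. t \<ge> 1 \<Longrightarrow> W z t \<ge> 0"
  shows "((\<lambda>t. t powr (2 + p) * W z t) \<longlongrightarrow> 0) at_top"
proof -
  obtain l where l: "(energy z \<longlongrightarrow> l) at_top"
    using energy_convergent[OF W] by blast
  have half: "filterlim (\<lambda>t::real. t / 2) at_top at_top"
    by real_asymp
  have lim: "((\<lambda>t. (energy z (t / 2) - energy z t) * 2 powr (2 + p) / \<eta>) \<longlongrightarrow> (l - l) * 2 powr (2 + p) / \<eta>) at_top"
    using \<eta>_pos by (intro tendsto_intros l filterlim_compose[OF l half]) auto
  have upper: "eventually (\<lambda>t. t powr (2 + p) * W z t \<le> (energy z (t / 2) - energy z t) * 2 powr (2 + p) / \<eta>) at_top"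
    using eventually_ge_at_top[of 2]
  proof eventually_elim
    case (elim t)
    define s where "s = t / 2"
    have s: "s \<ge> 1" "t = 2 * s" using elim by (auto simp: s_def)
    have "energy z t + \<eta> * (s powr (1 + p) * W z t) * (t - s) \<le> energy z s"
    proof (rule energy_decrease)
      fix r assume r: "r \<in> {s..t}"
      then have "s powr (1 + p) \<le> r powr (1 + p)" "W z t \<le> W z r"
        using s p_nonneg by (auto intro!: powr_mono2 W_decreasing)
      then show "\<eta> * (s powr (1 + p) * W z t) \<le> \<eta> * (r powr (1 + p) * W z r)"
        using \<eta>_pos W[of t] s by (intro mult_left_mono mult_mono) auto
    qed (use s in auto)
    moreover have "s powr (1 + p) * (t - s) = s powr (2 + p)"
      using s by (simp add: powr_add powr_numeral power2_eq_square)
    moreover have "\<eta> * (s powr (1 + p) * W z t) * (t - s) = \<eta> * ((s powr (1 + p) * (t - s)) * W z t)"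
      by simp
    ultimately have "\<eta> * (s powr (2 + p) * W z t) \<le> energy z s - energy z t"
      by simp
    moreover have "t powr (2 + p) = s powr (2 + p) * 2 powr (2 + p)"
      using s by (simp add: powr_mult)
    ultimately have "\<eta> * (t powr (2 + p) * W z t) \<le> (energy z s - energy z t) * 2 powr (2 + p)"
      using mult_right_mono[of "\<eta> * (s powr (2 + p) * W z t)" "energy z s - energy z t" "2 powr (2 + p)"]
      by (simp add: mult_ac)
    then show ?case
      using \<eta>_pos by (simp add: s_def pos_le_divide_eq mult.commute)
  qed
  have lower: "eventually (\<lambda>t. 0 \<le> t powr (2 + p) * W z t) at_top"
    using eventually_ge_at_top[of 1] by eventually_elim (simp add: W)
  show ?thesis
    by (rule tendsto_sandwich[OF lower upper tendsto_const]) (use lim in simp)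
qed

text \<open>Dividing by \<open>\<Lambda> * k\<close>, the convergence of the energy and the rate for
  \<open>W\<close> say that \<open>h t + t * h' t / k\<close> converges, with \<open>h'\<close> the
  derivative of \<open>h\<close>. This is the quotient of the derivatives of
  \<open>t powr k * h t\<close> and \<open>t powr k\<close>, so l'Hospital's rule shows that
  \<open>h\<close> itself converges.\<close>

lemma x_tendsto:
  assumes W: "\<And>t. t \<ge> 1 \<Longrightarrow> W z t \<ge> 0"
    and s: "filterlim s at_top sequentially" "(\<lambda>n. x (s n)) \<longlonglongrightarrow> z"
  shows "(x \<longlongrightarrow> z) at_top"
proof -
  define h where "h = (\<lambda>t. inner (x t - z) (x t - z) / 2)"
  define k where "k = \<alpha> - 1"
  have k: "k > 0" using p_nonneg p_less by (simp add: k_def)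
  obtain l where l: "(energy z \<longlongrightarrow> l) at_top"
    using energy_convergent[OF W] by blast
  have "((\<lambda>t. (energy z t - t powr (2 + p) * W z t) / (\<Lambda> * k)) \<longlongrightarrow> (l - 0) / (\<Lambda> * k)) at_top"
    using k \<Lambda>_pos by (intro tendsto_intros l W_rate[OF W]) auto
  moreover have "eventually (\<lambda>t. (energy z t - t powr (2 + p) * W z t) / (\<Lambda> * k)
      = (k * t powr (k - 1) * h t + inner (x t - z) (V t) * t powr k) / (k * t powr (k - 1))) at_top"
    using eventually_ge_at_top[of 1]
  proof eventually_elim
    case (elim t)
    have tk: "t powr k = t powr (k - 1) * t" using elim by (simp add: powr_diff)
    have "t powr (k - 1) > 0" using elim by simp
    then have "(k * t powr (k - 1) * h t + inner (x t - z) (V t) * t powr k) / (k * t powr (k - 1))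
        = h t + t * inner (x t - z) (V t) / k"
      using k unfolding tk by (simp add: field_simps)
    moreover have "energy z t - t powr (2 + p) * W z t = \<Lambda> * (t * inner (x t - z) (V t)) + \<Lambda> * k * h t"
      using energy_eq[OF elim, of z] by (simp add: k_def h_def)
    ultimately show ?case using k \<Lambda>_pos by (simp add: add_divide_distrib)
  qed
  ultimately have quot: "((\<lambda>t. (k * t powr (k - 1) * h t + inner (x t - z) (V t) * t powr k)
      / (k * t powr (k - 1))) \<longlongrightarrow> l / (\<Lambda> * k)) at_top"
    using tendsto_cong by fastforce
  have "((\<lambda>t. (t powr k * h t) / t powr k) \<longlongrightarrow> l / (\<Lambda> * k)) at_top"
  proof (rule lhospital_at_top_at_top[OF _ _ _ _ quot])
    show "filterlim (\<lambda>t. t powr k) at_top at_top" using k by real_asymp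
    show "eventually (\<lambda>t. k * t powr (k - 1) \<noteq> 0) at_top"
      using eventually_gt_at_top[of 0] by eventually_elim (use k in auto)
    have d: "((\<lambda>t. t powr k) has_real_derivative k * t powr (k - 1)) (at t)" if "t > 1" for t
      using that by (auto intro!: derivative_eq_intros)
    show "eventually (\<lambda>t. ((\<lambda>t. t powr k) has_real_derivative k * t powr (k - 1)) (at t)) at_top"
      using eventually_gt_at_top[of 1] by eventually_elim (rule d)
    show "eventually (\<lambda>t. ((\<lambda>t. t powr k * h t) has_real_derivative
        k * t powr (k - 1) * h t + inner (x t - z) (V t) * t powr k) (at t)) at_top"
      using eventually_gt_at_top[of 1]
      by eventually_elim (unfold h_def, intro DERIV_mult d half_sq_deriv)
  qed
  moreover have "eventually (\<lambda>t. (t powr k * h t) / t powr k = h t) at_top"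
    using eventually_gt_at_top[of 0] by eventually_elim auto
  ultimately have h: "(h \<longlongrightarrow> l / (\<Lambda> * k)) at_top"
    using tendsto_cong by fastforce
  \<comment> \<open>The limit of \<open>h\<close> is identified along the sequence \<open>s\<close>,
    on which the trajectory tends to \<open>z\<close>.\<close>
  have "(\<lambda>n. h (s n)) \<longlonglongrightarrow> l / (\<Lambda> * k)"
    by (rule filterlim_compose[OF h s(1)])
  moreover have "(\<lambda>n. h (s n)) \<longlonglongrightarrow> inner (z - z) (z - z) / 2"
    unfolding h_def by (intro tendsto_intros s(2)) auto
  ultimately have "l / (\<Lambda> * k) = 0" using LIMSEQ_unique by fastforce
  then have "((\<lambda>t. sqrt (2 * h t)) \<longlongrightarrow> sqrt (2 * 0)) at_top"
    using h by (intro tendsto_intros) auto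
  then have "((\<lambda>t. norm (x t - z)) \<longlongrightarrow> 0) at_top"
    by (simp add: h_def norm_eq_sqrt_inner)
  then show ?thesis by (simp add: LIM_zero_iff tendsto_norm_zero_iff)
qed

section \<open>Weak Pareto optimality of the limit\<close>

text \<open>The dissipation estimate holds for every reference point, so it can be applied to a
  hypothetical dominating point \<open>y\<close> in place of the limit.\<close>

lemma limit_weakly_pareto:
  assumes lim: "(x \<longlongrightarrow> z) at_top"
  shows "z \<in> weakly_pareto F"
proof (rule ccontr)
  assume "z \<notin> weakly_pareto F"
  then obtain y where y: "\<And>i. F y $ i < F z $ i" by (auto simp: weakly_pareto_def)
  \<comment> \<open>Half of the smallest gap: strictly below every limiting difference, hence
    eventually exceeded in all components at once.\<close>
  define \<epsilon> where "\<epsilon> = (MIN i. (F z $ i - F y $ i) / 2)"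
  have \<epsilon>: "\<epsilon> > 0" unfolding \<epsilon>_def using y by (subst Min_gr_iff) auto
  have "eventually (\<lambda>t. F (x t) $ i - F y $ i > \<epsilon>) at_top" for i
  proof (rule order_tendstoD(1))
    show "((\<lambda>t. F (x t) $ i - F y $ i) \<longlongrightarrow> F z $ i - F y $ i) at_top"
      using continuous_on_tendsto_compose[OF F_cont[of UNIV] lim] by (intro tendsto_diff tendsto_const) auto
    have "\<epsilon> \<le> (F z $ i - F y $ i) / 2" unfolding \<epsilon>_def by (rule Min_le) auto
    then show "\<epsilon> < F z $ i - F y $ i" using \<epsilon> by (simp add: field_simps)
  qed
  then have "eventually (\<lambda>t. \<forall>i. F (x t) $ i - F y $ i > \<epsilon>) at_top"
    by (rule eventually_all_finite)
  then obtain T where T: "\<And>t i. t \<ge> T \<Longrightarrow> F (x t) $ i - F y $ i > \<epsilon>"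
    unfolding eventually_at_top_linorder by blast
  define a where "a = max T 1"
  have \<sigma>: "\<sigma> y t \<ge> \<epsilon>" if "t \<ge> a" for t
    using T[of t] that by (auto simp: a_def intro!: Min.boundedI less_imp_le)
  define c where "c = \<eta> * \<epsilon>"
  have c: "c > 0" using \<eta>_pos \<epsilon> by (simp add: c_def)
  \<comment> \<open>Late enough for the guaranteed loss \<open>c * (b - a)\<close> to exceed the
    energy at \<open>a\<close> by \<open>c\<close>.\<close>
  define b where "b = a + energy y a / c + 1"
  have a1: "a \<ge> 1" by (simp add: a_def)
  have Ea: "energy y a \<ge> 0"
    by (rule energy_nonneg_of_sigma_nonneg[OF a1 order_trans[OF less_imp_le[OF \<epsilon>] \<sigma>]]) simp
  have ab: "a \<le> b" using Ea c by (simp add: b_def)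
  have "energy y b + c * (b - a) \<le> energy y a"
  proof (rule energy_decrease[OF a1 ab])
    fix t assume t: "t \<in> {a..b}"
    have t1: "1 \<le> t" using t a1 by auto
    have "\<epsilon> \<le> W y t"
      using \<sigma>[of t] t t1 by (simp add: energy_W_def add_increasing2)
    moreover have "1 \<le> t powr (1 + p)" using t1 p_nonneg by (intro ge_one_powr_ge_zero) auto
    ultimately have "1 * \<epsilon> \<le> t powr (1 + p) * W y t"
      using \<epsilon> by (intro mult_mono) auto
    then show "c \<le> \<eta> * (t powr (1 + p) * W y t)"
      using \<eta>_pos by (simp add: c_def)
  qed
  moreover have "energy y b \<ge> 0"
    by (rule energy_nonneg_of_sigma_nonneg[OF _ order_trans[OF less_imp_le[OF \<epsilon>] \<sigma>]]) (use a1 ab in auto)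
  moreover have "c * (b - a) = energy y a + c" using c by (simp add: b_def field_simps)
  ultimately show False using c by linarith
qed

end

theorem theorem4p3:
  fixes F :: "real ^ 'n \<Rightarrow> real ^ 'm"
    and x :: "real \<Rightarrow> real ^ 'n" and x0 :: "real ^ 'n"
    and p \<alpha> L :: real
  assumes "0 \<le> p" and "p < \<alpha> - 3" and "L > 0"
    and "\<And>i. convex_on UNIV (\<lambda>y. F y $ i)"
    and "\<And>i. bdd_below (range (\<lambda>y. F y $ i))"
    and "\<And>i y. (\<lambda>z. F z $ i) differentiable (at y)"
    and "\<And>i. L-lipschitz_on UNIV (gradient (\<lambda>y. F y $ i))"
    and "assumption_R F"
    and "mits_solution \<alpha> (\<lambda>t. t powr p) F x0 x"
    and "bounded (x ` {1..})"
  shows "\<exists>xs. (x \<longlongrightarrow> xs) at_top \<and> xs \<in> weakly_pareto F \<and>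
    energy_W p F x xs \<in> o[at_top](\<lambda>t. 1 / t powr (2 + p))"
proof -
  interpret mits F x x0 p \<alpha> L
    by unfold_locales (fact assms)+
  \<comment> \<open>The cluster point serves as the candidate limit; nonnegativity of its
    \<open>W\<close> gives both the convergence of the trajectory and the rate.\<close>
  obtain z s where s: "filterlim s at_top sequentially" "(\<lambda>n. x (s n)) \<longlonglongrightarrow> z"
    and W: "\<And>t. t \<ge> 1 \<Longrightarrow> energy_W p F x z t \<ge> 0"
    using cluster_point[OF assms(10)] by metis
  have lim: "(x \<longlongrightarrow> z) at_top" by (rule x_tendsto[OF W s])
  have "energy_W p F x z \<in> o[at_top](\<lambda>t. 1 / t powr (2 + p))"
  proof (rule smalloI_tendsto)
    show "((\<lambda>t. energy_W p F x z t / (1 / t powr (2 + p))) \<longlongrightarrow> 0) at_top"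
      using W_rate[OF W] by (simp add: mult.commute)
    show "eventually (\<lambda>t. 1 / t powr (2 + p) \<noteq> 0) at_top"
      using eventually_gt_at_top[of 0] by eventually_elim auto
  qed
  then show ?thesis using lim limit_weakly_pareto[OF lim] by blast
qed

end
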